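(* Let $a,b\in\mathbb{R}$. Suppose that $S_{ab}$ has irrational rotation number and that $(0,1)$ and $(0,-1)$ lie in the same $T_{ab}$-orbit. Let $\mathcal{O}=\{T_{ab}^{(j)}(\mathbf{v}_0):1\le j\le m\}$ be any finite segment of that orbit which contains all the orbit points strictly between $(0,1)$ and $(0,-1)$ together with whichever of $(0,1)$, $(0,-1)$ occurs later in the orbit. If $J=\mathbb{R}^+[\mathbf{v},\mathbf{v}')$ is a half-open sector with $\mathbf{v},\mathbf{v}'\in\mathcal{O}$ and containing no element of $\mathcal{O}$ in its interior, then the first return map $T_J$ of $T_{ab}$ to $J$ is piecewise linear with exactly two pieces, and the two linear maps $M_1,M_2$ corresponding to the two pieces commute: $M_1M_2=M_2M_1$.
   Context: For real parameters $a,b$, the map $T_{ab}:\mathbb{R}^2\to\mathbb{R}^2$ is $T_{ab}(x,y)=(ax-y,x)$ if $x\ge 0$ and $T_{ab}(x,y)=(bx-y,x)$ if $x<0$; it is a homeomorphism, positively homogeneous of degree one, mapping rays from the origin onto rays from the origin. $T_{ab}^{(j)}$ denotes the $j$-th iterate ($j\in\mathbb{Z}$). $S_{ab}:S^1\to S^1$, $S_{ab}(\mathbf{u})=T_{ab}(\mathbf{u})/|T_{ab}(\mathbf{u})|$, and $r(S_{ab})$ is its Poincaré rotation number (counterclockwise, in full turns). For nonzero $\mathbf{v},\mathbf{v}'$ not on a common ray, the half-open sector $\mathbb{R}^+[\mathbf{v},\mathbf{v}')$ is the set of points $t\mathbf{w}$, $t>0$, with $\mathbf{w}$ ranging over directions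 obtained by going counterclockwise from the direction of $\mathbf{v}$ (included) to the direction of $\mathbf{v}'$ (excluded). The first return map $T_J$ to a sector $J$ sends $\mathbf{w}\in J$ to $T_{ab}^{(k)}(\mathbf{w})$ where $k\ge1$ is minimal with $T_{ab}^{(k)}(\mathbf{w})\in J$. A map on $J$ is piecewise linear with exactly $k$ pieces if $J$ is divided by rays from the origin into $k$ subsectors on each of which it agrees with a linear map, and no coarser such division exists. *)

theory Defs
  imports "HOL-Analysis.Analysis"
begin

definition T :: "real \<Rightarrow> real \<Rightarrow> real \<times> real \<Rightarrow> real \<times> real" where
  "T a b p = (if fst p \<ge> 0 then (a * fst p - snd p, fst p) else (b * fst p - snd p, fst p))"

definition S :: "real \<Rightarrow> real \<Rightarrow> real \<times> real \<Rightarrow> real \<times> real" where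
  "S a b u = (1 / norm (T a b u)) *\<^sub>R T a b u"

definition circ :: "real \<Rightarrow> real \<times> real" where
  "circ \<theta> = (cos (2 * pi * \<theta>), sin (2 * pi * \<theta>))"

definition is_lift :: "(real \<times> real \<Rightarrow> real \<times> real) \<Rightarrow> (real \<Rightarrow> real) \<Rightarrow> bool" where
  "is_lift f F \<longleftrightarrow> continuous_on UNIV F \<and> (\<forall>\<theta>. circ (F \<theta>) = f (circ \<theta>))"

text \<open>Poincare rotation number (defined modulo the integers, via any lift).\<close>
definition has_rotation_number :: "(real \<times> real \<Rightarrow> real \<times> real) \<Rightarrow> real \<Rightarrow> bool" where
  "has_rotation_number f r \<longleftrightarrow>
     (\<exists>F. is_lift f F \<and> (\<forall>x. (\<lambda>n. ((F ^^ n) x - x) / real n) \<longlonglongrightarrow> r))"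

definition rot :: "real \<Rightarrow> real \<times> real \<Rightarrow> real \<times> real" where
  "rot \<theta> p = (cos \<theta> * fst p - sin \<theta> * snd p, sin \<theta> * fst p + cos \<theta> * snd p)"

definition ang :: "real \<times> real \<Rightarrow> real \<times> real \<Rightarrow> real" where
  "ang v w = (THE \<theta>. 0 \<le> \<theta> \<and> \<theta> < 2 * pi \<and> (\<exists>t>0. w = t *\<^sub>R rot \<theta> v))"

definition sector :: "real \<times> real \<Rightarrow> real \<times> real \<Rightarrow> (real \<times> real) set" where
  "sector v v' = {w. w \<noteq> 0 \<and> ang v w < ang v v'}"

definition first_return :: "real \<Rightarrow> real \<Rightarrow> (real \<times> real) set \<Rightarrow> real \<times> real \<Rightarrow> real \<times> real" where
  "first_return a b J w = (T a b ^^ (LEAST k. 0 < k \<and> (T a b ^^ k) w \<in> J)) w"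

text \<open>A division of sector v v' by rays at angles C (measured ccw from v, strictly inside);
  the piece starting at angle c (c = 0 or c in C) is half-open.\<close>
definition piece :: "real \<times> real \<Rightarrow> real \<times> real \<Rightarrow> real set \<Rightarrow> real \<Rightarrow> (real \<times> real) set" where
  "piece v v' C c = {w \<in> sector v v'. c \<le> ang v w \<and> (\<forall>c'\<in>C. c < c' \<longrightarrow> ang v w < c')}"

definition pl_division :: "real \<times> real \<Rightarrow> real \<times> real \<Rightarrow> (real \<times> real \<Rightarrow> real \<times> real) \<Rightarrow> real set \<Rightarrow> bool" where
  "pl_division v v' f C \<longleftrightarrow> finite C \<and> C \<subseteq> {0<..<ang v v'} \<and>
     (\<forall>c \<in> insert 0 C. \<exists>L. linear L \<and> (\<forall>w \<in> piece v v' C c. f w = L w))"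

definition pl_exactly :: "real \<times> real \<Rightarrow> real \<times> real \<Rightarrow> (real \<times> real \<Rightarrow> real \<times> real) \<Rightarrow> nat \<Rightarrow> bool" where
  "pl_exactly v v' f k \<longleftrightarrow> (\<exists>C. pl_division v v' f C \<and> card C + 1 = k \<and>
       \<not> (\<exists>C'. C' \<subset> C \<and> pl_division v v' f C'))"

end

theory Submission
  imports Defs
begin

text \<open>
  A lift \<open>F\<close> of the circle map is a strictly increasing degree one map of the line without
  periodic points modulo \<open>1\<close>. Since \<open>v\<close> and \<open>v'\<close> lie on one orbit, the sector is a fundamental
  interval of a power of \<open>F\<close>, so the backward orbit of \<open>v0\<close> meets its interior; let \<open>p\<close> be the
  first such point. Going forward from \<open>p\<close>, no orbit point enters the interior until the end of the
  segment, so by monotonicity the points before \<open>p\<close> return together, at the time when \<open>p\<close> hits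
  \<open>v'\<close>, and the points from \<open>p\<close> on return at the time when \<open>p\<close> hits \<open>v\<close>. The break directions
  \<open>(0, 1)\<close> and \<open>(0, -1)\<close> are forward images of \<open>p\<close>, so both return maps \<open>M1\<close>, \<open>M2\<close> are linear,
  and they have determinant one. They satisfy \<open>M1 p = v'\<close>, \<open>M2 p = v\<close> and \<open>M1 v = M2 v'\<close>, so
  \<open>M1 M2\<close> and \<open>M2 M1\<close> agree at \<open>p\<close> and have equal trace; by Cayley-Hamilton they also agree
  at the image of \<open>p\<close>. If that image is a multiple of \<open>p\<close>, aperiodicity makes the factor
  negative, and either both products are \<open>-1\<close> or \<open>v\<close> and \<open>v'\<close> would lie on one ray.
\<close>

section \<open>Circle homeomorphisms without periodic points\<close>

text \<open>Angles are counted in full turns, so this is equality of points on the circle;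
  \<open>circ_eq_iff\<close> makes that link.\<close>

definition eqz :: "real \<Rightarrow> real \<Rightarrow> bool" where
  "eqz x y \<longleftrightarrow> x - y \<in> \<int>"

lemma eqz_refl [simp]: "eqz x x"
  by (simp add: eqz_def)

lemma eqz_sym: "eqz x y \<Longrightarrow> eqz y x"
  unfolding eqz_def using Ints_minus by fastforce

lemma eqz_trans: "eqz x y \<Longrightarrow> eqz y z \<Longrightarrow> eqz x z"
  unfolding eqz_def using Ints_add[of "x - y" "y - z"] by simp

lemma eqz_obtain:
  assumes "eqz x y"
  obtains k :: int where "x = y + of_int k"
  using assms unfolding eqz_def by (metis Ints_cases add.commute diff_add_cancel)

lemma eqz_add_int [simp]: "eqz (x + of_int k) x"
  by (simp add: eqz_def)

lemma eqz_unique: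
  assumes "eqz x y" and "\<bar>x - y\<bar> < 1"
  shows "x = y"
proof -
  obtain k :: int where k: "x = y + of_int k"
    using eqz_obtain[OF assms(1)] .
  with assms(2) have "\<bar>k\<bar> < 1" by linarith
  with k show ?thesis by simp
qed

section \<open>Lifts of degree one and their iterates\<close>

locale circle_map =
  fixes F :: "real \<Rightarrow> real"
  assumes cont: "continuous_on UNIV F"
    and mono: "strict_mono F"
    and shift: "\<And>x. F (x + 1) = F x + 1"
begin

lemma pow_cont: "continuous_on A (F ^^ n)"
proof (induction n)
  case 0
  show ?case by (simp add: continuous_on_id)
next
  case (Suc n)
  have "continuous_on A (F \<circ> (F ^^ n))"
    using Suc cont continuous_on_compose continuous_on_subset subset_UNIV by blast
  then show ?case by simp
qed

lemma pow_less_iff [simp]: "(F ^^ n) x < (F ^^ n) y \<longleftrightarrow> x < y"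
  by (induction n) (use mono in \<open>auto simp: strict_mono_less\<close>)

lemma pow_le_iff [simp]: "(F ^^ n) x \<le> (F ^^ n) y \<longleftrightarrow> x \<le> y"
  using pow_less_iff[of n y x] by linarith

lemma shift_nat: "F (x + real k) = F x + real k"
proof (induction k)
  case (Suc k)
  have "F (x + real (Suc k)) = F (x + real k + 1)" by (simp add: algebra_simps)
  then show ?case using Suc shift by simp
qed simp

lemma shift_int: "F (x + of_int k) = F x + of_int k"
proof (cases "k \<ge> 0")
  case True
  then show ?thesis using shift_nat[of x "nat k"] by simp
next
  case False
  then show ?thesis using shift_nat[of "x + of_int k" "nat (- k)"] by simp
qed

lemma pow_shift_int: "(F ^^ n) (x + of_int k) = (F ^^ n) x + of_int k"
  by (induction n) (auto simp: shift_int)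

lemma eqz_pow_iff [simp]: "eqz ((F ^^ n) x) ((F ^^ n) y) \<longleftrightarrow> eqz x y"
proof
  assume "eqz ((F ^^ n) x) ((F ^^ n) y)"
  then obtain k :: int where "(F ^^ n) x = (F ^^ n) (y + of_int k)"
    by (metis eqz_obtain pow_shift_int)
  then have "x = y + of_int k"
    by (metis order_antisym order_refl pow_le_iff)
  then show "eqz x y" by simp
next
  assume "eqz x y"
  then show "eqz ((F ^^ n) x) ((F ^^ n) y)"
    by (metis eqz_obtain eqz_add_int pow_shift_int)
qed

end

section \<open>Lifts without periodic points modulo 1\<close>

locale circle_lift = circle_map +
  assumes aperiodic: "\<And>n x k. (F ^^ n) x = x + of_int k \<Longrightarrow> n = 0"
begin

lemma eqz_pow_self:
  assumes "eqz ((F ^^ n) x) x"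
  shows "n = 0"
  using assms aperiodic by (metis eqz_obtain)

lemma pow_split: "n \<le> m \<Longrightarrow> (F ^^ m) x = (F ^^ n) ((F ^^ (m - n)) x)"
  by (metis comp_apply funpow_add le_add_diff_inverse)

lemma eqz_pow_cancel:
  assumes "eqz ((F ^^ n) x) ((F ^^ m) y)" and "n \<le> m"
  shows "eqz x ((F ^^ (m - n)) y)"
  using assms by (simp add: pow_split)

lemma eqz_pow_eq:
  assumes "eqz ((F ^^ n) x) ((F ^^ m) x)"
  shows "n = m"
proof (cases "n \<le> m")
  case True
  then show ?thesis
    using eqz_pow_cancel[OF assms] eqz_pow_self eqz_sym by fastforce
next
  case False
  then show ?thesis
    using eqz_pow_cancel[OF eqz_sym[OF assms]] eqz_pow_self eqz_sym by fastforce
qed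

lemma pow_IVT:
  assumes "x \<le> y" and "(F ^^ n) x \<le> c" and "c \<le> (F ^^ n) y"
  obtains u where "x \<le> u" "u \<le> y" "(F ^^ n) u = c"
  using IVT'[of "F ^^ n" x c y] assms pow_cont by blast

text \<open>The displacement \<open>(F ^^ n) x - x\<close> is continuous and, by aperiodicity, never
  an integer for \<open>n > 0\<close>. By the intermediate value theorem it stays on one side of
  \<open>k\<close> once it is there at one point.\<close>

lemma displacement_less:
  assumes "n > 0" and "(F ^^ n) x0 < x0 + of_int k"
  shows "(F ^^ n) x < x + of_int k"
proof (rule ccontr)
  assume ge: "\<not> ?thesis"
  let ?g = "\<lambda>x. (F ^^ n) x - x"
  have c: "continuous_on A ?g" for A
    by (intro continuous_intros pow_cont)
  have "\<exists>u. ?g u = of_int k"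
  proof (cases "x0 \<le> x")
    case True
    then show ?thesis
      using IVT'[of ?g x0 "of_int k" x, OF _ _ _ c] ge assms(2) by force
  next
    case False
    then show ?thesis
      using IVT2'[of ?g x0 "of_int k" x, OF _ _ _ c] ge assms(2) by force
  qed
  then obtain u where "(F ^^ n) u = u + of_int k"
    by (metis add.commute diff_add_cancel)
  then show False using aperiodic assms(1) by blast
qed

lemma displacement_greater:
  assumes "n > 0" and "(F ^^ n) x0 > x0 + of_int k"
  shows "(F ^^ n) x > x + of_int k"
  using assms displacement_less[OF assms(1), of x k x0] aperiodic[of n x k]
  by (metis linorder_less_linear order_less_asym order_less_irrefl)

text \<open>Another lift of the same power of the circle map; a suitable \<open>c\<close> makes it
  carry one end of the gap to the other exactly, not only modulo 1.\<close>

definition translate :: "nat \<Rightarrow> int \<Rightarrow> real \<Rightarrow> real" where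
  "translate n c x = (F ^^ n) x + of_int c"

lemma translate_cont: "continuous_on A (translate n c ^^ t)"
proof (induction t)
  case 0
  show ?case by (simp add: continuous_on_id)
next
  case (Suc t)
  have "continuous_on UNIV (translate n c)"
    unfolding translate_def by (intro continuous_intros pow_cont)
  then have "continuous_on A (translate n c \<circ> (translate n c ^^ t))"
    using Suc continuous_on_compose continuous_on_subset subset_UNIV by blast
  then show ?case by simp
qed

lemma translate_pow_eqz: "eqz ((translate n c ^^ t) u) ((F ^^ (n * t)) u)"
proof (induction t)
  case (Suc t)
  have "eqz ((translate n c ^^ Suc t) u) ((F ^^ n) ((translate n c ^^ t) u))"
    by (simp add: translate_def)
  moreover have "eqz ((F ^^ n) ((translate n c ^^ t) u)) ((F ^^ n) ((F ^^ (n * t)) u))"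
    using Suc by simp
  moreover have "(F ^^ n) ((F ^^ (n * t)) u) = (F ^^ (n * Suc t)) u"
    by (simp add: funpow_add)
  ultimately show ?case using eqz_trans by metis
qed simp

text \<open>Continuity makes the limit of an orbit a fixed point. As the translates below have none,
  their monotone orbits are unbounded.\<close>

lemma translate_limit:
  assumes "(\<lambda>t. (translate n c ^^ t) u) \<longlonglongrightarrow> L"
  shows "translate n c L = L"
proof -
  have "isCont (translate n c) L"
    using translate_cont[of UNIV 1 n c] by (simp add: continuous_on_eq_continuous_at)
  then have "(\<lambda>t. translate n c ((translate n c ^^ t) u)) \<longlonglongrightarrow> translate n c L"
    using assms isCont_tendsto_compose by blast
  moreover have "(\<lambda>t. (translate n c ^^ Suc t) u) \<longlonglongrightarrow> L"
    using assms LIMSEQ_Suc[of "\<lambda>t. (translate n c ^^ t) u"] by blast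
  ultimately show ?thesis
    using LIMSEQ_unique by fastforce
qed

text \<open>The consecutive images of a fundamental interval \<open>[V, H V)\<close> of a fixed point free
  translate \<open>H\<close> of a power of \<open>F\<close> fill the line, whence every point visits such an interval.\<close>

lemma fundamental_up:
  assumes "n > 0" and HV: "(F ^^ n) V + of_int c = V'" and "V < V'" and "V \<le> x"
  obtains t y where "V \<le> y" "y < V'" "eqz ((F ^^ t) y) x"
proof -
  let ?H = "translate n c"
  let ?X = "\<lambda>t. (?H ^^ t) V"
  have move: "?H x > x" for x
    using displacement_greater[of n V "- c" x] assms unfolding translate_def by auto
  have "\<exists>t. ?X t > x"
  proof (rule ccontr)
    assume "\<not> ?thesis"
    then have bdd: "?X t \<le> x" for t by (meson not_less)
    have mon: "incseq ?X"
      using move by (intro incseq_SucI) (simp add: less_imp_le)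
    then obtain L where "?X \<longlonglongrightarrow> L"
      using incseq_convergent[OF mon] bdd by metis
    then show False using translate_limit move[of L] by fastforce
  qed
  then have "\<exists>t. ?X t > x \<and> (\<forall>s<t. \<not> ?X s > x)"
    using exists_least_iff[of "\<lambda>t. ?X t > x"] by blast
  then obtain t where t: "?X t > x" "\<And>s. s < t \<Longrightarrow> \<not> ?X s > x" by blast
  then obtain s where "t = Suc s"
    using \<open>V \<le> x\<close> by (cases t) auto
  with t have s: "?X (Suc s) > x" "?X s \<le> x"
    by (auto simp: not_less not_le)
  have a: "(?H ^^ s) V \<le> x" using s by simp
  \<comment> \<open>\<open>?H V = V'\<close>, so \<open>x\<close> lies between the images of
    \<open>V\<close> and \<open>V'\<close> under the same power \<open>s\<close> of
    \<open>?H\<close>.\<close>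
  have b: "x < (?H ^^ s) V'"
    using s HV by (simp add: funpow_swap1 translate_def)
  obtain y where y: "V \<le> y" "y \<le> V'" "(?H ^^ s) y = x"
    using IVT'[OF a less_imp_le[OF b] less_imp_le[OF \<open>V < V'\<close>] translate_cont] by blast
  then have "y < V'" using b by (cases "y = V'") auto
  moreover have "eqz ((F ^^ (n * s)) y) x"
    using translate_pow_eqz[where n = n and c = c and t = s and u = y] y eqz_sym by auto
  ultimately show ?thesis using that y(1) by blast
qed

text \<open>The mirror case, in which the orbit reaches \<open>V'\<close> before \<open>V\<close>:
  the translate moves points down, and the intervals descend from \<open>V'\<close>.\<close>

lemma fundamental_down:
  assumes "n > 0" and HV: "(F ^^ n) V' + of_int c = V" and "V < V'" and "x < V'"
  obtains t y where "V \<le> y" "y < V'" "eqz ((F ^^ t) y) x"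
proof -
  let ?H = "translate n c"
  let ?X = "\<lambda>t. (?H ^^ t) V'"
  have move: "?H x < x" for x
    using displacement_less[of n V' "- c" x] assms unfolding translate_def by auto
  have "\<exists>t. ?X t \<le> x"
  proof (rule ccontr)
    assume "\<not> ?thesis"
    then have bdd: "x \<le> ?X t" for t by (meson less_imp_le not_less)
    have mon: "decseq ?X"
      using move by (intro decseq_SucI) (simp add: less_imp_le)
    then obtain L where "?X \<longlonglongrightarrow> L"
      using decseq_convergent[OF mon] bdd by metis
    then show False using translate_limit move[of L] by fastforce
  qed
  then have "\<exists>t. ?X t \<le> x \<and> (\<forall>s<t. \<not> ?X s \<le> x)"
    using exists_least_iff[of "\<lambda>t. ?X t \<le> x"] by blast
  then obtain t where t: "?X t \<le> x" "\<And>s. s < t \<Longrightarrow> \<not> ?X s \<le> x" by blast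
  then obtain s where "t = Suc s"
    using \<open>x < V'\<close> by (cases t) auto
  with t have s: "?X (Suc s) \<le> x" "?X s > x"
    by (auto simp: not_less not_le)
  have b: "x < (?H ^^ s) V'" using s by simp
  have a: "(?H ^^ s) V \<le> x"
    using s HV by (simp add: funpow_swap1 translate_def)
  obtain y where y: "V \<le> y" "y \<le> V'" "(?H ^^ s) y = x"
    using IVT'[OF a less_imp_le[OF b] less_imp_le[OF \<open>V < V'\<close>] translate_cont] by blast
  then have "y < V'" using b by (cases "y = V'") auto
  moreover have "eqz ((F ^^ (n * s)) y) x"
    using translate_pow_eqz[where n = n and c = c and t = s and u = y] y eqz_sym by auto
  ultimately show ?thesis using that y(1) by blast
qed

text \<open>The power of \<open>F\<close> carrying the earlier of \<open>V\<close>,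
  \<open>V'\<close> to the later has the gap as fundamental interval, so some gap point reaches
  \<open>x\<close>. Taking the time \<open>k\<close> minimal gives the avoidance: a gap point met
  after \<open>t\<close> steps would reach \<open>x\<close> in only \<open>k - t\<close>.\<close>

lemma backward_visit:
  assumes V: "eqz ((F ^^ i) x) V" and V': "eqz ((F ^^ j) x) V'"
    and "i > 0" and "V < V'" and "V' < V + 1"
  obtains k P where "V < P" "P < V'" "eqz ((F ^^ k) P) x"
    "\<And>t y. 1 \<le> t \<Longrightarrow> t \<le> k \<Longrightarrow> V < y \<Longrightarrow> y < V' \<Longrightarrow> \<not> eqz ((F ^^ t) P) y"
proof -
  have "i \<noteq> j"
    using V V' assms(4,5) eqz_unique[of V V'] by (metis abs_minus_commute abs_of_pos diff_less_eq
        eqz_sym eqz_trans add.commute less_irrefl diff_gt_0_iff_gt)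
  have "\<exists>t y. V \<le> y \<and> y < V' \<and> eqz ((F ^^ t) y) x"
  proof (cases "i < j")
    case True
    have "(F ^^ j) x = (F ^^ (j - i)) ((F ^^ i) x)"
      using True pow_split[of "j - i" j x] by simp
    then have "eqz V' ((F ^^ (j - i)) V)"
      using V V' by (metis eqz_pow_iff eqz_sym eqz_trans)
    then obtain c :: int where "(F ^^ (j - i)) V + of_int c = V'"
      by (metis eqz_obtain)
    moreover have "V \<le> x + of_int \<lceil>V - x\<rceil>"
      using le_of_int_ceiling[of "V - x"] by linarith
    ultimately show ?thesis
      using fundamental_up[of "j - i" V c V' "x + of_int \<lceil>V - x\<rceil>"] True \<open>V < V'\<close> eqz_add_int eqz_trans
      by (metis zero_less_diff)
  next
    case False
    with \<open>i \<noteq> j\<close> have ij: "j < i" by simp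
    have "(F ^^ i) x = (F ^^ (i - j)) ((F ^^ j) x)"
      using ij pow_split[of "i - j" i x] by simp
    then have "eqz V ((F ^^ (i - j)) V')"
      using V V' by (metis eqz_pow_iff eqz_sym eqz_trans)
    then obtain c :: int where "(F ^^ (i - j)) V' + of_int c = V"
      by (metis eqz_obtain)
    moreover have "x + of_int (\<lfloor>V - x\<rfloor>) < V'"
      using of_int_floor_le[of "V - x"] \<open>V < V'\<close> by linarith
    ultimately show ?thesis
      using fundamental_down[of "i - j" V' c V "x + of_int \<lfloor>V - x\<rfloor>"] ij \<open>V < V'\<close> eqz_add_int eqz_trans
      by (metis zero_less_diff)
  qed
  then obtain t y where ty: "V \<le> y" "y < V'" "eqz ((F ^^ t) y) x" by blast
  \<comment> \<open>\<open>V\<close> lies on the forward orbit of \<open>x\<close> because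
    \<open>i > 0\<close>, so reaching \<open>x\<close> from \<open>V\<close> would close a
    cycle.\<close>
  have "y \<noteq> V"
  proof
    assume "y = V"
    then have "eqz ((F ^^ t) ((F ^^ i) x)) x"
      using ty(3) V by (metis eqz_pow_iff eqz_trans)
    then have "t + i = 0"
      using eqz_pow_self[of "t + i" x] by (simp add: funpow_add)
    then show False using \<open>i > 0\<close> by simp
  qed
  then have "\<exists>k. \<exists>P. V < P \<and> P < V' \<and> eqz ((F ^^ k) P) x"
    using ty by force
  then obtain k where "\<exists>P. V < P \<and> P < V' \<and> eqz ((F ^^ k) P) x"
    and least: "\<And>s. s < k \<Longrightarrow> \<not> (\<exists>P. V < P \<and> P < V' \<and> eqz ((F ^^ s) P) x)"
    using exists_least_iff[of "\<lambda>k. \<exists>P. V < P \<and> P < V' \<and> eqz ((F ^^ k) P) x"] by blast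
  then obtain P where P: "V < P" "P < V'" "eqz ((F ^^ k) P) x" by blast
  show ?thesis
  proof (rule that[OF P])
    fix t y assume t: "1 \<le> t" "t \<le> k" and y: "V < y" "y < V'"
    show "\<not> eqz ((F ^^ t) P) y"
    proof
      assume "eqz ((F ^^ t) P) y"
      then have "eqz ((F ^^ (k - t)) y) ((F ^^ (k - t)) ((F ^^ t) P))"
        using eqz_sym by simp
      then have "eqz ((F ^^ (k - t)) y) ((F ^^ k) P)"
        using t pow_split[of "k - t" k P] by simp
      then show False using least[of "k - t"] t y eqz_trans[OF _ P(3)] by (metis One_nat_def Suc_le_lessD diff_less less_le_trans)
    qed
  qed
qed

end

text \<open>The gap \<open>(V, V')\<close> is bounded by two points of the forward orbit of \<open>P\<close>, and \<open>P\<close> is the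
  last point of that orbit segment in it.\<close>

locale circle_gap = circle_lift +
  fixes V P V' :: real and \<alpha> \<beta> M :: nat
  assumes VP: "V < P" and PV': "P < V'" and gap1: "V' < V + 1"
    and \<alpha>: "eqz ((F ^^ \<alpha>) P) V'" "0 < \<alpha>" "\<alpha> \<le> M"
    and \<beta>: "eqz ((F ^^ \<beta>) P) V" "0 < \<beta>" "\<beta> \<le> M"
    and avoid: "\<And>t y. 1 \<le> t \<Longrightarrow> t \<le> M \<Longrightarrow> V < y \<Longrightarrow> y < V' \<Longrightarrow> \<not> eqz y ((F ^^ t) P)"
begin

definition in_gap :: "real \<Rightarrow> bool" where
  "in_gap x \<longleftrightarrow> (\<exists>y. V \<le> y \<and> y < V' \<and> eqz x y)"

text \<open>If \<open>w\<close> came back at time \<open>n\<close>, then, up to one integer shift,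
  its image would lie in the gap and that of \<open>P\<close> beyond \<open>V'\<close>. Some
  \<open>u\<close> strictly between \<open>w\<close> and \<open>P\<close> would go to
  \<open>V'\<close>, so \<open>u\<close> would be the orbit point of \<open>P\<close> at time
  \<open>\<alpha> - n\<close>, which \<open>avoid\<close> keeps out of the gap.\<close>

lemma left_avoid:
  assumes w: "V \<le> w" "w < P" and n: "0 < n" "n < \<alpha>"
  shows "\<not> in_gap ((F ^^ n) w)"
proof
  assume "in_gap ((F ^^ n) w)"
  then obtain y where y: "V \<le> y" "y < V'" "eqz y ((F ^^ n) w)"
    unfolding in_gap_def using eqz_sym by blast
  then obtain c :: int where c: "y = (F ^^ n) w + of_int c" using eqz_obtain by blast
  let ?GP = "(F ^^ n) P + of_int c"
  have "(F ^^ n) w < (F ^^ n) P" using w by simp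
  then have 1: "V < ?GP" using y c by linarith
  have 2: "\<not> ?GP < V'"
    using avoid[of n ?GP] 1 n \<alpha> by auto
  have 3: "?GP \<noteq> V'"
  proof
    assume "?GP = V'"
    then have "eqz ((F ^^ n) P) ((F ^^ \<alpha>) P)"
      using \<alpha>(1) by (metis eqz_add_int eqz_sym eqz_trans)
    then show False using eqz_pow_eq n by blast
  qed
  obtain u where u: "w \<le> u" "u \<le> P" "(F ^^ n) u = V' - of_int c"
    using pow_IVT[of w P n "V' - of_int c"] w y c 2 by (metis diff_add_cancel add_diff_cancel
        diff_le_eq le_diff_eq linorder_not_less order_less_imp_le)
  have uP: "u < P" using u 3 by (metis diff_add_cancel order_le_less)
  have uw: "w < u" using u c y by (metis diff_add_cancel order_le_less order_less_irrefl)
  have "eqz ((F ^^ n) u) ((F ^^ \<alpha>) P)"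
    using u(3) \<alpha>(1) by (metis diff_add_cancel eqz_add_int eqz_sym eqz_trans)
  then have "eqz u ((F ^^ (\<alpha> - n)) P)"
    using eqz_pow_cancel n by simp
  moreover have "\<not> eqz u ((F ^^ (\<alpha> - n)) P)"
    using avoid[of "\<alpha> - n" u] n \<alpha> uw uP w PV' by linarith
  ultimately show False by simp
qed

text \<open>\<open>F ^^ \<alpha>\<close> sends \<open>P\<close> to \<open>V'\<close> modulo 1 and
  \<open>w\<close> below it. Were the image of \<open>w\<close> outside the gap, some
  \<open>u\<close> between \<open>w\<close> and \<open>P\<close> would go to \<open>V\<close>, that
  is, to the orbit point of \<open>P\<close> at time \<open>\<beta>\<close>.\<close>

lemma left_return:
  assumes w: "V \<le> w" "w < P"
  shows "in_gap ((F ^^ \<alpha>) w)"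
proof (rule ccontr)
  assume no: "\<not> ?thesis"
  obtain c :: int where c: "V' = (F ^^ \<alpha>) P + of_int c"
    using \<alpha>(1) eqz_sym eqz_obtain by blast
  have lt: "(F ^^ \<alpha>) w + of_int c < V'" using w c by simp
  have lt2: "(F ^^ \<alpha>) w + of_int c < V"
  proof (rule ccontr)
    assume "\<not> ?thesis"
    then show False
      using no lt unfolding in_gap_def by (meson eqz_add_int eqz_sym not_less)
  qed
  obtain u where u: "w \<le> u" "u \<le> P" "(F ^^ \<alpha>) u = V - of_int c"
    using pow_IVT[of w P \<alpha> "V - of_int c"] w lt2 c VP PV' by auto
  have uP: "u < P" using u c VP PV' by (cases "u = P") auto
  have uw: "w < u" using u lt2 by (cases "u = w") auto
  have "eqz ((F ^^ \<alpha>) u) V"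
    using u(3) by (metis diff_add_cancel eqz_add_int eqz_sym)
  then have eq: "eqz ((F ^^ \<alpha>) u) ((F ^^ \<beta>) P)"
    using \<beta>(1) eqz_sym eqz_trans by blast
  have ne: "\<alpha> \<noteq> \<beta>"
    using eq uP uw w VP PV' gap1 eqz_unique[of u P] by fastforce
  show False
  proof (cases "\<alpha> < \<beta>")
    case True
    then have "eqz u ((F ^^ (\<beta> - \<alpha>)) P)" using eqz_pow_cancel[OF eq] by simp
    then show False
      using avoid[of "\<beta> - \<alpha>" u] True \<beta> uw uP w PV' by linarith
  next
    case False
    with ne have ba: "\<beta> < \<alpha>" by simp
    \<comment> \<open>This power carries \<open>V\<close> to \<open>V'\<close> and \<open>u\<close>
      to \<open>P\<close> modulo 1. Since \<open>V < u\<close> but \<open>V' > P\<close>, the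
      integer corrections satisfy \<open>d - e \<ge> 1\<close>, and the displacement bound read off
      at \<open>u\<close> then puts \<open>V'\<close> more than 1 above \<open>V\<close>.\<close>
    let ?n = "\<alpha> - \<beta>"
    have "eqz P ((F ^^ ?n) u)"
      using eqz_pow_cancel[OF eqz_sym[OF eq]] ba by simp
    then obtain e :: int where e: "P = (F ^^ ?n) u + of_int e" using eqz_obtain by blast
    have "(F ^^ \<alpha>) P = (F ^^ ?n) ((F ^^ \<beta>) P)"
      using pow_split[of ?n \<alpha> P] ba by simp
    then have "eqz V' ((F ^^ ?n) V)"
      using \<alpha>(1) \<beta>(1) by (metis eqz_pow_iff eqz_sym eqz_trans)
    then obtain d :: int where d: "V' = (F ^^ ?n) V + of_int d" using eqz_obtain by blast
    have n0: "?n > 0" using ba by simp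
    have "(F ^^ ?n) V < (F ^^ ?n) u" using w uw by simp
    then have "V' < P + of_int (d - e)" using d e by simp
    then have "of_int (d - e) > (0::real)" using PV' by linarith
    then have "d - e \<ge> 1" by linarith
    then have de: "real_of_int (d - e) \<ge> 1" by linarith
    have "(F ^^ ?n) u > u + of_int (1 - d)"
      using e de uP by simp
    then have "(F ^^ ?n) V > V + of_int (1 - d)"
      using displacement_greater[OF n0] by blast
    then show False using d gap1 by simp
  qed
qed

text \<open>The mirror image of \<open>left_avoid\<close>: the image of the interval from
  \<open>P\<close> to \<open>w\<close> now crosses \<open>V\<close>, and \<open>\<beta>\<close>
  replaces \<open>\<alpha>\<close>.\<close>

lemma right_avoid:
  assumes w: "P \<le> w" "w < V'" and n: "0 < n" "n < \<beta>"
  shows "\<not> in_gap ((F ^^ n) w)"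
proof
  assume "in_gap ((F ^^ n) w)"
  then obtain y where y: "V \<le> y" "y < V'" "eqz y ((F ^^ n) w)"
    unfolding in_gap_def using eqz_sym by blast
  then obtain c :: int where c: "y = (F ^^ n) w + of_int c" using eqz_obtain by blast
  let ?GP = "(F ^^ n) P + of_int c"
  have "(F ^^ n) P \<le> (F ^^ n) w" using w by simp
  then have 1: "?GP < V'" using y c by linarith
  have 2: "\<not> V < ?GP"
    using avoid[of n ?GP] 1 n \<beta> by auto
  have 3: "?GP \<noteq> V"
  proof
    assume "?GP = V"
    then have "eqz ((F ^^ n) P) ((F ^^ \<beta>) P)"
      using \<beta>(1) by (metis eqz_add_int eqz_sym eqz_trans)
    then show False using eqz_pow_eq n by blast
  qed
  obtain u where u: "P \<le> u" "u \<le> w" "(F ^^ n) u = V - of_int c"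
    using pow_IVT[of P w n "V - of_int c"] w y c 2 by (metis diff_add_cancel add_diff_cancel
        diff_le_eq le_diff_eq linorder_not_less order_less_imp_le)
  have uP: "P < u" using u 3 by (metis diff_add_cancel order_le_less)
  have "eqz ((F ^^ n) u) ((F ^^ \<beta>) P)"
    using u(3) \<beta>(1) by (metis diff_add_cancel eqz_add_int eqz_sym eqz_trans)
  then have "eqz u ((F ^^ (\<beta> - n)) P)"
    using eqz_pow_cancel n by simp
  moreover have "\<not> eqz u ((F ^^ (\<beta> - n)) P)"
    using avoid[of "\<beta> - n" u] n \<beta> uP u w VP by linarith
  ultimately show False by simp
qed

text \<open>As for \<open>left_return\<close>, with ends and times exchanged; the last case forces
  \<open>V\<close> more than 1 below \<open>V'\<close>.\<close>

lemma right_return: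
  assumes w: "P \<le> w" "w < V'"
  shows "in_gap ((F ^^ \<beta>) w)"
proof (rule ccontr)
  assume no: "\<not> ?thesis"
  obtain c :: int where c: "V = (F ^^ \<beta>) P + of_int c"
    using \<beta>(1) eqz_sym eqz_obtain by blast
  have lt: "V \<le> (F ^^ \<beta>) w + of_int c" using w c by simp
  have lt2: "V' \<le> (F ^^ \<beta>) w + of_int c"
  proof (rule ccontr)
    assume "\<not> ?thesis"
    then show False
      using no lt unfolding in_gap_def by (meson eqz_add_int eqz_sym not_less)
  qed
  obtain u where u: "P \<le> u" "u \<le> w" "(F ^^ \<beta>) u = V' - of_int c"
    using pow_IVT[of P w \<beta> "V' - of_int c"] w lt2 c VP PV' by auto
  have uP: "P < u" using u c VP PV' by (cases "u = P") auto
  have "eqz ((F ^^ \<beta>) u) V'"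
    using u(3) by (metis diff_add_cancel eqz_add_int eqz_sym)
  then have eq: "eqz ((F ^^ \<beta>) u) ((F ^^ \<alpha>) P)"
    using \<alpha>(1) eqz_sym eqz_trans by blast
  have ne: "\<beta> \<noteq> \<alpha>"
    using eq uP u(2) w VP PV' gap1 eqz_unique[of u P] by fastforce
  show False
  proof (cases "\<beta> < \<alpha>")
    case True
    then have "eqz u ((F ^^ (\<alpha> - \<beta>)) P)" using eqz_pow_cancel[OF eq] by simp
    then show False
      using avoid[of "\<alpha> - \<beta>" u] True \<alpha> u uP w VP by linarith
  next
    case False
    with ne have ba: "\<alpha> < \<beta>" by simp
    let ?n = "\<beta> - \<alpha>"
    have "eqz P ((F ^^ ?n) u)"
      using eqz_pow_cancel[OF eqz_sym[OF eq]] ba by simp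
    then obtain e :: int where e: "P = (F ^^ ?n) u + of_int e" using eqz_obtain by blast
    have "(F ^^ \<beta>) P = (F ^^ ?n) ((F ^^ \<alpha>) P)"
      using pow_split[of ?n \<beta> P] ba by simp
    then have "eqz V ((F ^^ ?n) V')"
      using \<alpha>(1) \<beta>(1) by (metis eqz_pow_iff eqz_sym eqz_trans)
    then obtain d :: int where d: "V = (F ^^ ?n) V' + of_int d" using eqz_obtain by blast
    have n0: "?n > 0" using ba by simp
    have "(F ^^ ?n) u < (F ^^ ?n) V'" using w u by simp
    then have "P + of_int (d - e) < V" using d e by simp
    then have "of_int (d - e) < (0::real)" using VP by linarith
    then have "d - e \<le> -1" by linarith
    then have de: "real_of_int (d - e) \<le> -1" by linarith
    have "(F ^^ ?n) u < u + of_int (- 1 - d)"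
      using e de uP by simp
    then have "(F ^^ ?n) V' < V' + of_int (- 1 - d)"
      using displacement_less[OF n0] by blast
    then show False using d gap1 by simp
  qed
qed

text \<open>A break point that is reached before the first return lies on the orbit of \<open>P\<close>; pulling it
  back to the gap gives either an orbit point of the segment or a point returning at \<open>P\<close>.\<close>

lemma left_no_break:
  assumes y: "V < y" "y < P" and n: "n < \<alpha>" and "\<sigma> \<le> M"
  shows "\<not> eqz ((F ^^ n) y) ((F ^^ \<sigma>) P)"
proof
  assume eq: "eqz ((F ^^ n) y) ((F ^^ \<sigma>) P)"
  consider "n < \<sigma>" | "n = \<sigma>" | "\<sigma> < n" by linarith
  then show False
  proof cases
    case 1
    then have "eqz y ((F ^^ (\<sigma> - n)) P)" using eqz_pow_cancel[OF eq] by simp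
    then show False using avoid[of "\<sigma> - n" y] 1 assms PV' by linarith
  next
    case 2
    then show False using eq y eqz_unique[of y P] PV' gap1 by auto
  next
    case 3
    then have "eqz P ((F ^^ (n - \<sigma>)) y)" using eqz_pow_cancel[OF eqz_sym[OF eq]] by simp
    then have "in_gap ((F ^^ (n - \<sigma>)) y)"
      unfolding in_gap_def using VP PV' eqz_sym less_imp_le by blast
    then show False using left_avoid[of y "n - \<sigma>"] y n 3 by simp
  qed
qed

lemma right_no_break:
  assumes y: "P < y" "y < V'" and n: "n < \<beta>" and "\<sigma> \<le> M"
  shows "\<not> eqz ((F ^^ n) y) ((F ^^ \<sigma>) P)"
proof
  assume eq: "eqz ((F ^^ n) y) ((F ^^ \<sigma>) P)"
  consider "n < \<sigma>" | "n = \<sigma>" | "\<sigma> < n" by linarith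
  then show False
  proof cases
    case 1
    then have "eqz y ((F ^^ (\<sigma> - n)) P)" using eqz_pow_cancel[OF eq] by simp
    then show False using avoid[of "\<sigma> - n" y] 1 assms VP by linarith
  next
    case 2
    then show False using eq y eqz_unique[of y P] VP gap1 by auto
  next
    case 3
    then have "eqz P ((F ^^ (n - \<sigma>)) y)" using eqz_pow_cancel[OF eqz_sym[OF eq]] by simp
    then have "in_gap ((F ^^ (n - \<sigma>)) y)"
      unfolding in_gap_def using VP PV' eqz_sym less_imp_le by blast
    then show False using right_avoid[of y "n - \<sigma>"] y n 3 by simp
  qed
qed

end

section \<open>Area-preserving linear maps of the plane\<close>

text \<open>The determinant of the pair. Determinant one is expressed throughout as preservation of
  this form, which needs no matrices; on unit vectors it is the sine of the angle between them
  (\<open>area_circ\<close>).\<close>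

definition area :: "real \<times> real \<Rightarrow> real \<times> real \<Rightarrow> real" where
  "area u w = fst u * snd w - snd u * fst w"

lemma area_scale [simp]: "area (c *\<^sub>R u) w = c * area u w" "area u (c *\<^sub>R w) = c * area u w"
  by (simp_all add: area_def algebra_simps)

lemma area_self [simp]: "area u u = 0"
  by (simp add: area_def)

lemma area_decompose:
  assumes "area u w \<noteq> 0"
  shows "z = (area z w / area u w) *\<^sub>R u + (area u z / area u w) *\<^sub>R w"
proof -
  have "area u w * fst z = area z w * fst u + area u z * fst w"
    "area u w * snd z = area z w * snd u + area u z * snd w"
    by (simp_all add: area_def algebra_simps)
  then show ?thesis using assms by (simp add: prod_eq_iff field_simps)
qed

lemma area_eq_0_imp_scale:
  assumes "area u z = 0" "u \<noteq> 0"
  obtains c where "z = c *\<^sub>R u"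
proof (cases "fst u = 0")
  case True
  then have "snd u \<noteq> 0" using assms(2) by (simp add: prod_eq_iff)
  then show ?thesis using that[of "snd z / snd u"] assms True
    by (simp add: area_def prod_eq_iff)
next
  case False
  then show ?thesis using that[of "fst z / fst u"] assms
    by (simp add: area_def prod_eq_iff field_simps)
qed

lemma linear_eq_on_basis:
  fixes A B :: "real \<times> real \<Rightarrow> real \<times> real"
  assumes "linear A" "linear B" "area u w \<noteq> 0" "A u = B u" "A w = B w"
  shows "A = B"
proof
  fix z
  obtain c d where z: "z = c *\<^sub>R u + d *\<^sub>R w" using area_decompose[OF assms(3)] by blast
  show "A z = B z"
    using assms by (simp add: z linear_add linear_scale)
qed

section \<open>Trace, Cayley-Hamilton and commuting maps\<close>

definition tr :: "(real \<times> real \<Rightarrow> real \<times> real) \<Rightarrow> real" where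
  "tr A = fst (A (1, 0)) + snd (A (0, 1))"

lemma linear_coords:
  fixes A :: "real \<times> real \<Rightarrow> real \<times> real"
  assumes "linear A"
  shows "A z = fst z *\<^sub>R A (1, 0) + snd z *\<^sub>R A (0, 1)"
proof -
  have "z = fst z *\<^sub>R (1, 0) + snd z *\<^sub>R (0, 1)" by (simp add: prod_eq_iff)
  then have "A z = A (fst z *\<^sub>R (1, 0) + snd z *\<^sub>R (0, 1))" by simp
  then show ?thesis by (simp only: linear_add[OF assms] linear_scale[OF assms])
qed

lemma tr_comp_commute:
  assumes "linear A" "linear B"
  shows "tr (A \<circ> B) = tr (B \<circ> A)"
  unfolding tr_def comp_def
  using linear_coords[OF assms(1), of "B (1,0)"] linear_coords[OF assms(1), of "B (0,1)"]
    linear_coords[OF assms(2), of "A (1,0)"] linear_coords[OF assms(2), of "A (0,1)"]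
  by (simp add: algebra_simps)

lemma Cayley_Hamilton_area:
  assumes "linear A" and pres: "\<And>u w. area (A u) (A w) = area u w"
  shows "A (A z) = tr A *\<^sub>R A z - z"
proof -
  obtain x y where z: "z = (x, y)" by fastforce
  obtain p q where e: "A (1, 0) = (p, q)" by fastforce
  obtain r s where f: "A (0, 1) = (r, s)" by fastforce
  \<comment> \<open>Preserving the area of the standard basis says exactly that the determinant is
    1.\<close>
  have d: "p * s - q * r = 1" using pres[of "(1,0)" "(0,1)"] by (simp add: e f area_def)
  have A: "A (x, y) = (p * x + r * y, q * x + s * y)" for x y
    using linear_coords[OF assms(1), of "(x, y)"] by (simp add: e f algebra_simps)
  have "p * (p * x + r * y) + r * (q * x + s * y) =
      (p + s) * (p * x + r * y) - (p * s - q * r) * x"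
    "q * (p * x + r * y) + s * (q * x + s * y) =
      (p + s) * (q * x + s * y) - (p * s - q * r) * y"
    by (simp_all add: algebra_simps)
  then show ?thesis by (simp add: z A tr_def e f d)
qed

text \<open>Here \<open>p\<close> is the dividing vector and \<open>v\<close>, \<open>v'\<close> are
  the ends of the sector. The conditions \<open>pos\<close> and \<open>ray\<close> settle the
  degenerate case in which \<open>M v\<close> is a multiple of \<open>p\<close>.\<close>

lemma area_preserving_commute:
  fixes M N :: "real \<times> real \<Rightarrow> real \<times> real"
  assumes lin: "linear M" "linear N"
    and areaM: "\<And>u w. area (M u) (M w) = area u w"
    and areaN: "\<And>u w. area (N u) (N w) = area u w"
    and p: "p \<noteq> 0" "M p = v'" "N p = v" "M v = N v'"
    and pos: "\<And>c. M v = c *\<^sub>R p \<Longrightarrow> c \<le> 0" "\<And>c. v = c *\<^sub>R p \<Longrightarrow> c \<le> 0"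
      "\<And>c. v' = c *\<^sub>R p \<Longrightarrow> c \<le> 0"
    and ray: "\<not> (\<exists>t>0. v' = t *\<^sub>R v)"
  shows "M \<circ> N = N \<circ> M"
proof -
  let ?A = "M \<circ> N" and ?B = "N \<circ> M"
  define q where "q = M v"
  have linA: "linear ?A" and linB: "linear ?B"
    using lin linear_compose by blast+
  have areaA: "area (?A u) (?A w) = area u w" and areaB: "area (?B u) (?B w) = area u w" for u w
    using areaM areaN by simp_all
  have Ap: "?A p = q" "?B p = q" using p by (simp_all add: q_def)
  show ?thesis
  proof (cases "area p q = 0")
    case False
    \<comment> \<open>Both products send \<open>p\<close> to \<open>q\<close> and have the same
      trace, so Cayley-Hamilton at \<open>p\<close> gives the same value at
      \<open>q\<close>.\<close>
    have "?A q = ?B q"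
      using Cayley_Hamilton_area[OF linA areaA, of p] Cayley_Hamilton_area[OF linB areaB, of p]
        tr_comp_commute[OF lin] by (simp only: Ap)
    then show ?thesis using linear_eq_on_basis[OF linA linB False] Ap by simp
  next
    case True
    then obtain l where l: "q = l *\<^sub>R p" using area_eq_0_imp_scale p(1) by blast
    then have l0: "l \<le> 0" using pos(1) q_def by simp
    \<comment> \<open>Apply \<open>M\<close> to the pair \<open>v\<close>, \<open>p\<close> and
      \<open>N\<close> to the pair \<open>p\<close>, \<open>v'\<close>. Unless the areas vanish,
      this yields \<open>l * l = 1\<close>, hence \<open>l = -1\<close> by
      \<open>l0\<close>.\<close>
    have e1: "area v p = l * area p v'"
      using areaM[of v p] p l q_def by simp
    have e2: "area p v' = l * area v p"
      using areaN[of p v'] p l q_def by simp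
    show ?thesis
    proof (cases "area v p = 0")
      case False
      have "area v p = l * l * area v p" using e1 e2 by (simp add: mult.assoc)
      then have "l * l = 1" using False by simp
      then have l1: "l = -1" using l0 by (metis abs_of_nonpos abs_mult_self_eq abs_1
            minus_equation_iff mult_1 abs_square_eq_1 power2_eq_square)
      have "area p (v' - v) = 0"
        using e1 l1 by (simp add: area_def algebra_simps)
      then obtain c where "v' - v = c *\<^sub>R p" using area_eq_0_imp_scale p(1) by blast
      then have c: "v' = v + c *\<^sub>R p" by (simp add: algebra_simps)
      have Mv: "M v = - p" and Nv': "N v' = - p" using l l1 p q_def by simp_all
      have "N v = - p - c *\<^sub>R v"
        using Nv' lin(2) p(3) unfolding c by (simp add: linear_add linear_scale algebra_simps)
      \<comment> \<open>With \<open>q = - p\<close>, both products are minus the identity on the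
        basis \<open>p\<close>, \<open>v\<close>.\<close>
      then have "?A v = - v"
        using lin(1) p(2) Mv c by (simp add: linear_diff linear_scale linear_neg)
      moreover have "?B v = - v" using Mv p(3) lin(2) by (simp add: linear_neg)
      moreover have "area p v \<noteq> 0" using False by (simp add: area_def algebra_simps)
      ultimately show ?thesis using linear_eq_on_basis[OF linA linB] Ap by metis
    next
      case True
      then have "area p v = 0" "area p v' = 0" using e2 by (simp_all add: area_def algebra_simps)
      then obtain c c' where c: "v = c *\<^sub>R p" and c': "v' = c' *\<^sub>R p"
        using area_eq_0_imp_scale p(1) by metis
      \<comment> \<open>This makes the factors \<open>c\<close>, \<open>c'\<close> nonzero, so
        \<open>v\<close> and \<open>v'\<close> are both negative multiples of \<open>p\<close> and
        share a ray.\<close>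
      have inj: "N p \<noteq> 0" "M p \<noteq> 0"
      proof -
        have "\<exists>z. area p z \<noteq> 0"
        proof (rule ccontr)
          assume "\<nexists>z. area p z \<noteq> 0"
          then have "area p (1, 0) = 0" "area p (0, 1) = 0" by auto
          then show False using p(1) by (simp add: area_def prod_eq_iff)
        qed
        then obtain z where z: "area p z \<noteq> 0" by blast
        show "N p \<noteq> 0" using z areaN[of p z] by (auto simp: area_def)
        show "M p \<noteq> 0" using z areaM[of p z] by (auto simp: area_def)
      qed
      then have "c < 0" "c' < 0"
        using pos(2)[OF c] pos(3)[OF c'] c c' p by (auto simp: order_le_less)
      then have "v' = (c' / c) *\<^sub>R v" "c' / c > 0" using c c' by (auto simp: divide_neg_neg)
      then show ?thesis using ray by blast
    qed
  qed
qed

section \<open>Polar coordinates and sectors\<close>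

lemma circ_add_int [simp]: "circ (x + of_int k) = circ x"
proof -
  have "2 * pi * (x + of_int k) = 2 * pi * x + 2 * pi * of_int k" by (simp add: algebra_simps)
  then show ?thesis
    unfolding circ_def by (simp only: sin_add cos_add sin_int_2pin cos_int_2pin) simp
qed

lemma norm_circ [simp]: "norm (circ x) = 1"
  by (simp add: circ_def norm_Pair)

lemma circ_nonzero [simp]: "circ x \<noteq> 0"
  using norm_circ[of x] by fastforce

lemma continuous_circ: "continuous_on A circ"
  unfolding circ_def by (intro continuous_intros)

lemma area_circ: "area (circ x) (circ y) = sin (2 * pi * (y - x))"
  by (simp add: area_def circ_def sin_diff algebra_simps)

lemma circ_eq_iff: "circ x = circ y \<longleftrightarrow> eqz x y"
proof
  assume "circ x = circ y"
  then have "sin (2 * pi * x) = sin (2 * pi * y) \<and> cos (2 * pi * x) = cos (2 * pi * y)"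
    by (simp add: circ_def)
  then obtain n :: int where "2 * pi * x = 2 * pi * y + 2 * pi * of_int n"
    using sin_cos_eq_iff by blast
  then have "2 * pi * x = 2 * pi * (y + of_int n)" by (simp add: algebra_simps)
  then have "x = y + of_int n" by simp
  then show "eqz x y" by simp
next
  assume "eqz x y"
  then show "circ x = circ y" by (metis circ_add_int eqz_obtain)
qed

lemma circ_half: "circ (x + 1 / 2) = - circ x"
  by (simp add: circ_def distrib_left)

lemma ray_eq_iff:
  assumes "r > 0" "t > 0"
  shows "r *\<^sub>R circ x = t *\<^sub>R circ y \<longleftrightarrow> r = t \<and> eqz x y"
proof
  assume eq: "r *\<^sub>R circ x = t *\<^sub>R circ y"
  then have "norm (r *\<^sub>R circ x) = norm (t *\<^sub>R circ y)" by simp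
  then have "r = t" using assms by simp
  then show "r = t \<and> eqz x y" using eq assms circ_eq_iff by auto
qed (use circ_eq_iff in auto)

lemma polar:
  assumes "w \<noteq> 0"
  obtains r \<theta> where "r > 0" "c \<le> \<theta>" "\<theta> < c + 1" "w = r *\<^sub>R circ \<theta>"
proof -
  define r where "r = norm w"
  have r: "r > 0" using assms by (simp add: r_def)
  obtain x y where w: "w = (x, y)" by fastforce
  have "x\<^sup>2 + y\<^sup>2 = r\<^sup>2" by (simp add: r_def w norm_Pair)
  moreover have "(x / r)\<^sup>2 + (y / r)\<^sup>2 = (x\<^sup>2 + y\<^sup>2) / r\<^sup>2"
    by (simp add: power_divide add_divide_distrib)
  ultimately have "(x / r)\<^sup>2 + (y / r)\<^sup>2 = 1"
    using r by simp
  then obtain t where t: "x / r = cos t" "y / r = sin t"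
    using sincos_total_2pi by blast
  let ?\<phi> = "t / (2 * pi)"
  let ?\<theta> = "?\<phi> + of_int \<lceil>c - ?\<phi>\<rceil>"
  have "w = r *\<^sub>R circ ?\<phi>" using t r by (simp add: circ_def w field_simps)
  then have "w = r *\<^sub>R circ ?\<theta>" by simp
  moreover have "c \<le> ?\<theta>" "?\<theta> < c + 1"
    using ceiling_correct[of "c - ?\<phi>"] by linarith+
  ultimately show ?thesis using that[OF r] by blast
qed

lemma rot_circ: "rot \<phi> (r *\<^sub>R circ x) = r *\<^sub>R circ (x + \<phi> / (2 * pi))"
proof -
  have "2 * pi * (x + \<phi> / (2 * pi)) = 2 * pi * x + \<phi>" by (simp add: field_simps)
  then show ?thesis by (simp add: rot_def circ_def sin_add cos_add algebra_simps)
qed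

text \<open>Converts \<open>ang\<close>, in radians, to lifted angles in full turns. The description
  is unique since two candidates are congruent modulo 1 and lie in a half-open window of length
  1.\<close>

lemma ang_circ:
  assumes "r > 0" "t > 0" "V \<le> \<theta>" "\<theta> < V + 1"
  shows "ang (r *\<^sub>R circ V) (t *\<^sub>R circ \<theta>) = 2 * pi * (\<theta> - V)"
  unfolding ang_def
proof (rule the_equality)
  have "t *\<^sub>R circ \<theta> = (t / r) *\<^sub>R rot (2 * pi * (\<theta> - V)) (r *\<^sub>R circ V)"
    using assms by (simp add: rot_circ)
  moreover have "2 * pi * (\<theta> - V) < 2 * pi * 1"
    using assms by (intro mult_strict_left_mono) auto
  ultimately show "0 \<le> 2 * pi * (\<theta> - V) \<and> 2 * pi * (\<theta> - V) < 2 * pi \<and>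
      (\<exists>s>0. t *\<^sub>R circ \<theta> = s *\<^sub>R rot (2 * pi * (\<theta> - V)) (r *\<^sub>R circ V))"
    using assms by (intro conjI exI[of _ "t / r"]) auto
next
  fix \<phi>
  assume "0 \<le> \<phi> \<and> \<phi> < 2 * pi \<and> (\<exists>s>0. t *\<^sub>R circ \<theta> = s *\<^sub>R rot \<phi> (r *\<^sub>R circ V))"
  then obtain s where \<phi>: "0 \<le> \<phi>" "\<phi> < 2 * pi" and "s > 0"
    and s: "t *\<^sub>R circ \<theta> = (s * r) *\<^sub>R circ (V + \<phi> / (2 * pi))"
    by (auto simp: rot_circ)
  then have "eqz \<theta> (V + \<phi> / (2 * pi))"
    using ray_eq_iff[of t "s * r"] assms by simp
  moreover have "0 \<le> \<phi> / (2 * pi)" "\<phi> / (2 * pi) < 1" using \<phi> by simp_all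
  ultimately have "\<theta> = V + \<phi> / (2 * pi)"
    using assms by (intro eqz_unique) linarith+
  then show "\<phi> = 2 * pi * (\<theta> - V)" by simp
qed

lemma sector_circ:
  assumes "r > 0" "r' > 0" "V \<le> V'" "V' < V + 1" "t > 0" "V \<le> \<theta>" "\<theta> < V + 1"
  shows "t *\<^sub>R circ \<theta> \<in> sector (r *\<^sub>R circ V) (r' *\<^sub>R circ V') \<longleftrightarrow> \<theta> < V'"
  using assms by (simp add: sector_def ang_circ)

lemma sin_2pi_pos:
  assumes "0 < x" "x < 1 / 2"
  shows "sin (2 * pi * x) > 0"
  using assms by (intro sin_gt_zero) (auto simp: field_simps)

lemma sin_2pi_nonneg:
  assumes "0 \<le> x" "x \<le> 1 / 2"
  shows "sin (2 * pi * x) \<ge> 0"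
  using assms by (intro sin_ge_zero) (auto simp: field_simps)

lemma interior_sector:
  assumes "r > 0" "r' > 0" "V' < V + 1" "t > 0" "V < \<theta>" "\<theta> < V'"
  shows "t *\<^sub>R circ \<theta> \<in> interior (sector (r *\<^sub>R circ V) (r' *\<^sub>R circ V'))"
proof -
  define e where "e = min (1 / 8) (min (\<theta> - V) (V' - \<theta>))"
  have e: "e > 0" "e \<le> 1 / 8" "V \<le> \<theta> - e" "\<theta> + e \<le> V'"
    using assms unfolding e_def by linarith+
  \<comment> \<open>The wedge between the angles \<open>\<theta> - e\<close> and
    \<open>\<theta> + e\<close>, as the intersection of two open half-planes.\<close>
  let ?U = "{w. area (circ (\<theta> - e)) w > 0} \<inter> {w. area w (circ (\<theta> + e)) > 0}"
  have "open ?U"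
    unfolding area_def by (intro open_Int open_Collect_less continuous_intros)
  moreover have "t *\<^sub>R circ \<theta> \<in> ?U"
    using assms e sin_2pi_pos[of e] by (simp add: area_circ)
  moreover have "?U \<subseteq> sector (r *\<^sub>R circ V) (r' *\<^sub>R circ V')"
  proof
    fix w assume w: "w \<in> ?U"
    then have "w \<noteq> 0" by (auto simp: area_def)
    then obtain s \<phi> where s: "s > 0" "\<theta> - 1 / 2 \<le> \<phi>" "\<phi> < \<theta> - 1 / 2 + 1" "w = s *\<^sub>R circ \<phi>"
      using polar by blast
    have 1: "sin (2 * pi * (\<phi> - (\<theta> - e))) > 0" and 2: "sin (2 * pi * (\<theta> + e - \<phi>)) > 0"
      using w s by (auto simp: area_circ zero_less_mult_iff)
    have "\<theta> - e < \<phi>"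
    proof (rule ccontr)
      assume "\<not> ?thesis"
      then have "sin (2 * pi * (\<theta> - e - \<phi>)) \<ge> 0"
        using s e by (intro sin_2pi_nonneg) auto
      moreover have "2 * pi * (\<theta> - e - \<phi>) = - (2 * pi * (\<phi> - (\<theta> - e)))" by (simp add: algebra_simps)
      ultimately show False using 1 by (simp only: sin_minus)
    qed
    moreover have "\<phi> < \<theta> + e"
    proof (rule ccontr)
      assume "\<not> ?thesis"
      then have "sin (2 * pi * (\<phi> - (\<theta> + e))) \<ge> 0"
        using s e by (intro sin_2pi_nonneg) auto
      moreover have "2 * pi * (\<phi> - (\<theta> + e)) = - (2 * pi * (\<theta> + e - \<phi>))" by (simp add: algebra_simps)
      ultimately show False using 2 by (simp only: sin_minus)
    qed
    ultimately show "w \<in> sector (r *\<^sub>R circ V) (r' *\<^sub>R circ V')"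
      using sector_circ[of r r' V V' s \<phi>] s e assms by simp
  qed
  ultimately show ?thesis by (meson interiorI)
qed

section \<open>The map on rays\<close>

definition branch :: "real \<Rightarrow> real \<times> real \<Rightarrow> real \<times> real" where
  "branch c p = (c * fst p - snd p, fst p)"

lemma linear_branch: "linear (branch c)"
  by (intro linearI) (auto simp: branch_def algebra_simps)

lemma area_branch [simp]: "area (branch c u) (branch c w) = area u w"
  by (simp add: branch_def area_def algebra_simps)

lemma T_right: "fst p \<ge> 0 \<Longrightarrow> T a b p = branch a p"
  by (simp add: T_def branch_def)

text \<open>The weak inequality is legitimate as both branches agree on the axis
  \<open>fst p = 0\<close>; this later gives linear formulas on closed arcs.\<close>

lemma T_left: "fst p \<le> 0 \<Longrightarrow> T a b p = branch b p"
  by (auto simp: T_def branch_def)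

lemma T_scale:
  assumes "r \<ge> 0"
  shows "T a b (r *\<^sub>R p) = r *\<^sub>R T a b p"
proof (cases "fst p \<ge> 0")
  case True
  then show ?thesis using assms T_right[of p] T_right[of "r *\<^sub>R p"] linear_branch
    by (simp add: linear_scale)
next
  case False
  then show ?thesis using assms T_left[of p] T_left[of "r *\<^sub>R p"] linear_branch
    by (simp add: linear_scale mult_nonneg_nonpos)
qed

lemma T_pow_scale:
  assumes "r \<ge> 0"
  shows "(T a b ^^ n) (r *\<^sub>R p) = r *\<^sub>R (T a b ^^ n) p"
  by (induction n) (use assms T_scale in auto)

lemma T_inject: "T a b p = T a b q \<Longrightarrow> p = q"
  by (auto simp: T_def prod_eq_iff split: if_splits)

lemma T_eq_0_iff [simp]: "T a b p = 0 \<longleftrightarrow> p = 0"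
  by (auto simp: T_def prod_eq_iff)

lemma T_pow_nonzero: "p \<noteq> 0 \<Longrightarrow> (T a b ^^ n) p \<noteq> 0"
  by (induction n) auto

lemma continuous_T: "continuous_on A (T a b)"
proof -
  have "T a b = (\<lambda>p. (a * max 0 (fst p) + b * min 0 (fst p) - snd p, fst p))"
    by (auto simp: T_def fun_eq_iff max_def min_def)
  then show ?thesis by (auto intro!: continuous_intros)
qed

lemma continuous_T_pow: "continuous_on A (T a b ^^ n)"
proof (induction n)
  case 0
  show ?case by (simp add: continuous_on_id)
next
  case (Suc n)
  have "continuous_on A (T a b \<circ> (T a b ^^ n))"
    using Suc continuous_T continuous_on_compose by blast
  then show ?case by simp
qed

text \<open>The vertical axis cuts the angles into half turns beginning at 1/4; the factor
  \<open>cos (pi * of_int k)\<close> is the sign that tells in which half-plane cell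
  \<open>k\<close> lies.\<close>

lemma T_circ_half_turn:
  fixes k :: int
  obtains c where "\<And>x. of_int k / 2 + 1 / 4 \<le> x \<Longrightarrow> x \<le> of_int k / 2 + 3 / 4 \<Longrightarrow>
    T a b (circ x) = branch c (circ x)"
proof -
  have fst_circ: "fst (circ x) = - cos (pi * of_int k) * sin (2 * pi * (x - (of_int k / 2 + 1 / 4)))"
    for x
  proof -
    have "2 * pi * x = (2 * pi * (x - (of_int k / 2 + 1 / 4)) + pi / 2) + pi * of_int k"
      by (simp add: field_simps)
    then have "cos (2 * pi * x) =
        cos ((2 * pi * (x - (of_int k / 2 + 1 / 4)) + pi / 2) + pi * of_int k)" by simp
    also have "\<dots> = cos (2 * pi * (x - (of_int k / 2 + 1 / 4)) + pi / 2) * cos (pi * of_int k)"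
      by (subst cos_add) (simp add: sin_times_pi_eq_0 mult.commute)
    also have "\<dots> = - cos (pi * of_int k) * sin (2 * pi * (x - (of_int k / 2 + 1 / 4)))"
      by (subst cos_add) simp
    finally show ?thesis by (simp add: circ_def)
  qed
  have sin: "sin (2 * pi * (x - (of_int k / 2 + 1 / 4))) \<ge> 0"
    if "of_int k / 2 + 1 / 4 \<le> x" "x \<le> of_int k / 2 + 3 / 4" for x
    using that by (intro sin_2pi_nonneg) auto
  show ?thesis
  proof (cases "cos (pi * of_int k) \<ge> 0")
    case True
    have "T a b (circ x) = branch b (circ x)"
      if "of_int k / 2 + 1 / 4 \<le> x" "x \<le> of_int k / 2 + 3 / 4" for x
      by (rule T_left, subst fst_circ) (use mult_nonneg_nonneg[OF True sin[OF that]] in linarith)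
    then show ?thesis using that by blast
  next
    case False
    then have neg: "- cos (pi * of_int k) \<ge> 0" by linarith
    have "T a b (circ x) = branch a (circ x)"
      if "of_int k / 2 + 1 / 4 \<le> x" "x \<le> of_int k / 2 + 3 / 4" for x
      by (rule T_right, subst fst_circ) (rule mult_nonneg_nonneg[OF neg sin[OF that]])
    then show ?thesis using that by blast
  qed
qed

section \<open>Monotonicity and degree of the lift\<close>

lemma T_circ:
  assumes "is_lift (S a b) F"
  obtains r where "r > 0" "T a b (circ x) = r *\<^sub>R circ (F x)"
proof (rule that)
  show "norm (T a b (circ x)) > 0" by simp
  show "T a b (circ x) = norm (T a b (circ x)) *\<^sub>R circ (F x)"
    using assms by (simp add: is_lift_def S_def)
qed

text \<open>Area preservation keeps the sine of the angle from \<open>F x\<close> to \<open>F z\<close> positive as \<open>z\<close> moves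
  away from \<open>x\<close>, so \<open>F z - F x\<close> cannot leave the interval \<open>(0, 1/2)\<close>.\<close>

lemma lift_arc:
  assumes lift: "is_lift (S a b) F"
    and br: "\<And>z. x \<le> z \<Longrightarrow> z \<le> y \<Longrightarrow> T a b (circ z) = branch c (circ z)"
    and xy: "x < y" "y \<le> x + 1 / 2"
  shows "F x < F y \<and> F y \<le> F x + 1 / 2 \<and> (y = x + 1 / 2 \<longrightarrow> F y = F x + 1 / 2)"
proof -
  have cont: "continuous_on A F" for A
    using lift continuous_on_subset unfolding is_lift_def by blast
  have sgn: "sin (2 * pi * (F z - F x)) > 0" if "x < z" "z \<le> y" "z < x + 1 / 2" for z
  proof -
    obtain r where r: "r > 0" "T a b (circ x) = r *\<^sub>R circ (F x)" using T_circ[OF lift] .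
    obtain s where s: "s > 0" "T a b (circ z) = s *\<^sub>R circ (F z)" using T_circ[OF lift] .
    have "area (T a b (circ x)) (T a b (circ z)) = area (circ x) (circ z)"
      using br that xy by simp
    then have "r * s * sin (2 * pi * (F z - F x)) = sin (2 * pi * (z - x))"
      by (simp add: r s area_circ mult.assoc mult.left_commute[of s r])
    moreover have "sin (2 * pi * (z - x)) > 0" using that by (intro sin_2pi_pos) auto
    ultimately show ?thesis using r s by (metis mult_pos_pos zero_less_mult_pos)
  qed
  have bound: "F x < F z \<and> F z < F x + 1 / 2" if z: "x < z" "z \<le> y" "z < x + 1 / 2" for z
  proof (rule ccontr)
    assume "\<not> ?thesis"
    then consider "F z \<le> F x" | "F z \<ge> F x + 1 / 2" by linarith
    then show False
    proof cases
      case 1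
      \<comment> \<open>The level is cut off at a quarter turn below \<open>F x\<close>, so that a
        point reaching it has an image where the sine is not positive.\<close>
      define d where "d = max (F z) (F x - 1 / 4)"
      obtain u where u: "x \<le> u" "u \<le> z" "F u = d"
        using IVT2'[of F z d x] 1 z cont[of "{x..z}"] by (auto simp: d_def)
      have d: "d \<le> F x" "F x - 1 / 4 \<le> d" "d = F x \<Longrightarrow> F z = F x"
        using 1 by (auto simp: d_def max_def split: if_splits)
      have "\<exists>u'. x < u' \<and> u' \<le> z \<and> F u' \<le> F x \<and> F u' \<ge> F x - 1 / 4"
      proof (cases "u = x")
        case True
        then show ?thesis using d(3) u z by (intro exI[of _ z]) auto
      next
        case False
        then show ?thesis using d u by (intro exI[of _ u]) auto
      qed
      then obtain u' where u': "x < u'" "u' \<le> z" "F u' \<le> F x" "F u' \<ge> F x - 1 / 4" by blast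
      have "sin (2 * pi * (F x - F u')) \<ge> 0"
        using u' by (intro sin_2pi_nonneg) auto
      moreover have "2 * pi * (F x - F u') = - (2 * pi * (F u' - F x))" by (simp add: algebra_simps)
      ultimately have "sin (2 * pi * (F u' - F x)) \<le> 0" by (simp only: sin_minus)
      then show False using sgn[of u'] u' z by simp
    next
      case 2
      obtain u where u: "x \<le> u" "u \<le> z" "F u = F x + 1 / 2"
        using IVT'[of F x "F x + 1 / 2" z] 2 z cont[of "{x..z}"] by auto
      then have "x < u" by (cases "u = x") auto
      then show False using sgn[of u] u z by simp
    qed
  qed
  show ?thesis
  proof (cases "y < x + 1 / 2")
    case True
    then show ?thesis using bound[of y] xy by auto
  next
    case False
    \<comment> \<open>The sine no longer decides at distance 1/2. Linearity of the branch gives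
      opposite images, and continuity confines \<open>F y\<close> to the closed half turn above
      \<open>F x\<close>.\<close>
    then have y: "y = x + 1 / 2" using xy by simp
    obtain r where r: "r > 0" "T a b (circ x) = r *\<^sub>R circ (F x)" using T_circ[OF lift] .
    obtain s where s: "s > 0" "T a b (circ y) = s *\<^sub>R circ (F y)" using T_circ[OF lift] .
    have "circ y = - circ x" using circ_half y by simp
    then have "T a b (circ y) = - T a b (circ x)"
      using br[of x] br[of y] xy linear_neg[OF linear_branch, of c "circ x"] by simp
    then have "s *\<^sub>R circ (F y) = r *\<^sub>R circ (F x + 1 / 2)"
      by (simp only: circ_half r s scaleR_minus_right)
    then have eq: "eqz (F y) (F x + 1 / 2)" using ray_eq_iff r s by blast
    have in_cl: "F y \<in> {F x..F x + 1 / 2}"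
    proof -
      have "F ` closure {x<..<y} \<subseteq> {F x..F x + 1 / 2}"
      proof (rule image_closure_subset)
        show "continuous_on (closure {x<..<y}) F" using cont .
        show "F ` {x<..<y} \<subseteq> {F x..F x + 1 / 2}"
          using bound y by (auto simp: less_imp_le)
      qed simp
      moreover have "y \<in> closure {x<..<y}" using xy by simp
      ultimately show ?thesis by blast
    qed
    have "F y = F x + 1 / 2"
      using eqz_unique[OF eq] in_cl by auto
    then show ?thesis by (intro conjI impI) linarith+
  qed
qed

text \<open>By the last clause of \<open>lift_arc\<close>, \<open>F\<close> gains exactly 1/2 across
  each half-turn cell.\<close>

lemma lift_grid:
  assumes lift: "is_lift (S a b) F"
  shows "F (of_int k / 2 + 1 / 4) = F (1 / 4) + of_int k / 2"
proof -
  have step: "F (of_int (k + 1) / 2 + 1 / 4) = F (of_int k / 2 + 1 / 4) + 1 / 2" for k :: int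
  proof -
    obtain c where c: "\<And>x. of_int k / 2 + 1 / 4 \<le> x \<Longrightarrow> x \<le> of_int k / 2 + 3 / 4 \<Longrightarrow>
      T a b (circ x) = branch c (circ x)" using T_circ_half_turn by blast
    show ?thesis
      using lift_arc[OF lift, of "of_int k / 2 + 1 / 4" "of_int (k + 1) / 2 + 1 / 4" c] c
      by (simp add: add_divide_distrib)
  qed
  show ?thesis
  proof (induction k rule: int_induct[where k = 0])
    case (step2 i)
    then show ?case using step[of "i - 1"] by (simp add: field_simps)
  next
    case (step1 i)
    then show ?case using step[of i] by (simp add: field_simps)
  qed simp
qed

lemma lift_cell:
  assumes lift: "is_lift (S a b) F"
    and x: "of_int k / 2 + 1 / 4 \<le> x" and xy: "x < y" and y: "y \<le> of_int k / 2 + 3 / 4"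
  shows "F x < F y"
proof -
  obtain c where c: "\<And>x. of_int k / 2 + 1 / 4 \<le> x \<Longrightarrow> x \<le> of_int k / 2 + 3 / 4 \<Longrightarrow>
      T a b (circ x) = branch c (circ x)" using T_circ_half_turn by blast
  show ?thesis using lift_arc[OF lift, of x y c] c x y xy by auto
qed

lemma lift_cell_bounds:
  assumes lift: "is_lift (S a b) F"
    and x: "of_int k / 2 + 1 / 4 \<le> x" "x < of_int k / 2 + 3 / 4"
  shows "F (1 / 4) + of_int k / 2 \<le> F x" "F x < F (1 / 4) + of_int (k + 1) / 2"
proof -
  have "F (of_int k / 2 + 1 / 4) \<le> F x"
    using lift_cell[OF lift, of k "of_int k / 2 + 1 / 4" x] x by (cases "x = of_int k / 2 + 1 / 4") auto
  then show "F (1 / 4) + of_int k / 2 \<le> F x" using lift_grid[OF lift, of k] by simp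
  have "F x < F (of_int (k + 1) / 2 + 1 / 4)"
    using x by (intro lift_cell[OF lift, of k]) (auto simp: add_divide_distrib)
  then show "F x < F (1 / 4) + of_int (k + 1) / 2" using lift_grid[OF lift, of "k + 1"] by simp
qed

lemma cell_exists:
  obtains k :: int where "of_int k / 2 + 1 / 4 \<le> x" "x < of_int k / 2 + (3 / 4 :: real)"
proof
  let ?k = "\<lfloor>2 * x - 1 / 2\<rfloor>"
  show "of_int ?k / 2 + 1 / 4 \<le> x" "x < of_int ?k / 2 + (3 / 4 :: real)"
    using floor_correct[of "2 * x - 1 / 2"] by (simp_all add: field_simps)
qed

lemma lift_strict_mono:
  assumes lift: "is_lift (S a b) F"
  shows "strict_mono F"
proof (rule strict_monoI)
  fix x y :: real assume xy: "x < y"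
  obtain k where k: "of_int k / 2 + 1 / 4 \<le> x" "x < of_int k / 2 + 3 / 4" using cell_exists .
  obtain l where l: "of_int l / 2 + 1 / 4 \<le> y" "y < of_int l / 2 + 3 / 4" using cell_exists .
  have "real_of_int k < real_of_int l + 1" using k l xy by linarith
  then consider "k = l" | "k + 1 \<le> l" by linarith
  then show "F x < F y"
  proof cases
    case 1
    then show ?thesis using lift_cell[OF lift k(1) xy] l by simp
  next
    case 2
    have "F x < F (1 / 4) + of_int (k + 1) / 2" using lift_cell_bounds[OF lift k] by blast
    also have "\<dots> \<le> F (1 / 4) + of_int l / 2"
      using 2 by (intro add_left_mono divide_right_mono) (simp_all only: of_int_le_iff zero_le_numeral)
    also have "\<dots> \<le> F y" using lift_cell_bounds[OF lift l] by blast
    finally show ?thesis .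
  qed
qed

text \<open>From \<open>is_lift\<close> the difference \<open>F (x + 1) - F x\<close> is only known
  to be an integer; the cell bounds place it less than 1 away from 1.\<close>

lemma lift_shift:
  assumes lift: "is_lift (S a b) F"
  shows "F (x + 1) = F x + 1"
proof -
  obtain k where k: "of_int k / 2 + 1 / 4 \<le> x" "x < of_int k / 2 + 3 / 4" using cell_exists .
  have k': "of_int (k + 2) / 2 + 1 / 4 \<le> x + 1" "x + 1 < of_int (k + 2) / 2 + 3 / 4"
    using k unfolding of_int_add add_divide_distrib by simp_all
  have "circ (F (x + 1)) = circ (F x + 1)"
    using lift circ_add_int[of x 1] circ_add_int[of "F x" 1] by (simp add: is_lift_def)
  then have "eqz (F (x + 1)) (F x + 1)" by (simp add: circ_eq_iff)
  moreover have "\<bar>F (x + 1) - (F x + 1)\<bar> < 1"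
    using lift_cell_bounds[OF lift k] lift_cell_bounds[OF lift k']
    unfolding of_int_add add_divide_distrib by auto
  ultimately show ?thesis by (rule eqz_unique)
qed

lemma circle_map_lift:
  assumes "is_lift (S a b) F"
  shows "circle_map F"
  by unfold_locales
    (use assms lift_strict_mono[OF assms] lift_shift[OF assms] in \<open>auto simp only: is_lift_def\<close>)

text \<open>A point with \<open>(F ^^ n) x = x + of_int k\<close> advances by \<open>k\<close> every
  \<open>n\<close> steps, so along multiples of \<open>n\<close> the average displacement is the
  constant \<open>k / n\<close>.\<close>

lemma (in circle_map) aperiodic_if_irrational:
  assumes lim: "\<And>x. (\<lambda>n. ((F ^^ n) x - x) / real n) \<longlonglongrightarrow> r" and "r \<notin> \<rat>"
    and per: "(F ^^ n) x = x + of_int k"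
  shows "n = 0"
proof (rule ccontr)
  assume n: "n \<noteq> 0"
  have iter: "(F ^^ (n * t)) x = x + real t * of_int k" for t
  proof (induction t)
    case (Suc t)
    have "(F ^^ (n * Suc t)) x = (F ^^ n) (x + of_int (int t * k))"
      using Suc by (simp add: funpow_add)
    also have "\<dots> = x + of_int k + of_int (int t * k)"
      by (simp only: pow_shift_int per)
    finally show ?case by (simp add: algebra_simps)
  qed simp
  \<comment> \<open>\<open>Suc t\<close> skips time 0, where the quotient is a division by
    zero.\<close>
  have "strict_mono (\<lambda>t. n * Suc t)" using n by (intro strict_monoI) simp
  then have "(\<lambda>t. ((F ^^ (n * Suc t)) x - x) / real (n * Suc t)) \<longlonglongrightarrow> r"
    using LIMSEQ_subseq_LIMSEQ[OF lim[of x], of "\<lambda>t. n * Suc t"] by (simp only: comp_def)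
  moreover have "((F ^^ (n * Suc t)) x - x) / real (n * Suc t) = of_int k / real n" for t
    unfolding iter using n by (simp del: of_nat_Suc mult_Suc_right)
  ultimately have "(\<lambda>t. of_int k / real n) \<longlonglongrightarrow> r" by simp
  then have "r = of_int k / real n" by (simp add: LIMSEQ_const_iff)
  then have "r \<in> \<rat>" by simp
  then show False using \<open>r \<notin> \<rat>\<close> by simp
qed

lemma circle_lift_rotation:
  assumes "has_rotation_number (S a b) r" and "r \<notin> \<rat>"
  obtains F where "is_lift (S a b) F" "circle_lift F"
proof -
  obtain F where F: "is_lift (S a b) F" "\<And>x. (\<lambda>n. ((F ^^ n) x - x) / real n) \<longlonglongrightarrow> r"
    using assms(1) unfolding has_rotation_number_def by blast
  have "circle_lift F"
    using circle_map_lift[OF F(1)] circle_map.aperiodic_if_irrational[OF _ F(2) assms(2)]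
    by (simp only: circle_lift_def circle_lift_axioms_def) blast
  then show ?thesis using that F by blast
qed

section \<open>Iterates along rays and arcs\<close>

lemma T_pow_ray:
  assumes "is_lift (S a b) F" "r > 0"
  obtains s where "s > 0" "(T a b ^^ n) (r *\<^sub>R circ x) = s *\<^sub>R circ ((F ^^ n) x)"
proof -
  have "\<exists>s>0. (T a b ^^ n) (r *\<^sub>R circ x) = s *\<^sub>R circ ((F ^^ n) x)"
  proof (induction n)
    case 0
    show ?case using assms by auto
  next
    case (Suc n)
    then obtain s where s: "s > 0" "(T a b ^^ n) (r *\<^sub>R circ x) = s *\<^sub>R circ ((F ^^ n) x)" by blast
    obtain t where t: "t > 0" "T a b (circ ((F ^^ n) x)) = t *\<^sub>R circ (F ((F ^^ n) x))"
      using T_circ[OF assms(1)] .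
    have "(T a b ^^ Suc n) (r *\<^sub>R circ x) = (s * t) *\<^sub>R circ ((F ^^ Suc n) x)"
      using s t by (simp add: T_scale)
    then show ?case using s t by (meson mult_pos_pos)
  qed
  then show ?thesis using that by blast
qed

lemma sign_const_closed:
  fixes f :: "real \<Rightarrow> real"
  assumes "continuous_on {x..y} f" and "\<And>z. x < z \<Longrightarrow> z < y \<Longrightarrow> f z \<noteq> 0"
  shows "(\<forall>z\<in>{x..y}. f z \<ge> 0) \<or> (\<forall>z\<in>{x..y}. f z \<le> 0)"
proof (rule ccontr)
  assume "\<not> ?thesis"
  then obtain s t where st: "s \<in> {x..y}" "t \<in> {x..y}" "f s < 0" "f t > 0"
    by (auto simp: not_le)
  have c: "continuous_on {min s t..max s t} f"
    using st by (intro continuous_on_subset[OF assms(1)]) auto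
  have "\<exists>z. min s t \<le> z \<and> z \<le> max s t \<and> f z = 0"
  proof (cases "s \<le> t")
    case True
    then show ?thesis using IVT'[of f s 0 t] c st by (auto simp: min_def max_def)
  next
    case False
    then show ?thesis using IVT2'[of f s 0 t] c st by (auto simp: min_def max_def)
  qed
  then obtain z where z: "min s t \<le> z" "z \<le> max s t" "f z = 0" by blast
  then have "z \<noteq> s" "z \<noteq> t" using st by auto
  then have "x < z" "z < y" using z st by (auto simp: min_def max_def split: if_splits)
  then show False using assms(2) z by blast
qed

text \<open>While the images of the open arc miss the vertical axis, each step is given by one
  branch for the whole arc, end points included; composing the branches gives
  \<open>L\<close>.\<close>

lemma T_pow_linear_on_arc:
  assumes "\<And>n \<theta>. n < N \<Longrightarrow> X < \<theta> \<Longrightarrow> \<theta> < Y \<Longrightarrow> fst ((T a b ^^ n) (circ \<theta>)) \<noteq> 0"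
  obtains L where "linear L" "\<And>u w. area (L u) (L w) = area u w"
    "\<And>r \<theta>. r \<ge> 0 \<Longrightarrow> X \<le> \<theta> \<Longrightarrow> \<theta> \<le> Y \<Longrightarrow> (T a b ^^ N) (r *\<^sub>R circ \<theta>) = L (r *\<^sub>R circ \<theta>)"
proof -
  have "\<exists>L. linear L \<and> (\<forall>u w. area (L u) (L w) = area u w) \<and>
    (\<forall>\<theta>\<in>{X..Y}. (T a b ^^ N) (circ \<theta>) = L (circ \<theta>))"
    using assms
  proof (induction N)
    case 0
    show ?case by (intro exI[of _ id]) (auto simp: linear_ident)
  next
    case (Suc N)
    then obtain L where L: "linear L" "\<forall>u w. area (L u) (L w) = area u w"
      "\<forall>\<theta>\<in>{X..Y}. (T a b ^^ N) (circ \<theta>) = L (circ \<theta>)" by fastforce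
    let ?f = "\<lambda>\<theta>. fst ((T a b ^^ N) (circ \<theta>))"
    have "continuous_on {X..Y} ?f"
      by (intro continuous_intros continuous_on_compose2[OF continuous_T_pow continuous_circ]) auto
    then have "(\<forall>\<theta>\<in>{X..Y}. ?f \<theta> \<ge> 0) \<or> (\<forall>\<theta>\<in>{X..Y}. ?f \<theta> \<le> 0)"
      using sign_const_closed[of X Y ?f] Suc.prems by simp
    then obtain c where c: "\<forall>\<theta>\<in>{X..Y}. T a b ((T a b ^^ N) (circ \<theta>)) = branch c ((T a b ^^ N) (circ \<theta>))"
      using T_left T_right by metis
    then show ?case
      using L linear_compose[OF L(1) linear_branch[of c]]
      by (intro exI[of _ "branch c \<circ> L"] conjI) (assumption, simp_all)
  qed
  then obtain L where L: "linear L" "\<forall>u w. area (L u) (L w) = area u w"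
    "\<forall>\<theta>\<in>{X..Y}. (T a b ^^ N) (circ \<theta>) = L (circ \<theta>)" by blast
  show ?thesis
    by (rule that[of L]) (use L in \<open>auto simp: T_pow_scale linear_scale\<close>)
qed

lemma fst_eq_0_ray:
  fixes w :: "real \<times> real"
  assumes "fst w = 0" "w \<noteq> 0"
  obtains r where "r > 0" "w = r *\<^sub>R (0, 1) \<or> w = r *\<^sub>R (0, - 1)"
proof (rule that[of "\<bar>snd w\<bar>"])
  show "\<bar>snd w\<bar> > 0" using assms by (auto simp: prod_eq_iff)
  show "w = \<bar>snd w\<bar> *\<^sub>R (0, 1) \<or> w = \<bar>snd w\<bar> *\<^sub>R (0, - 1)"
    using assms(1) by (auto simp: prod_eq_iff abs_if)
qed

lemma linear_eq_on_sector:
  fixes A B :: "real \<times> real \<Rightarrow> real \<times> real"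
  assumes "linear A" "linear B" "X < Y"
    and "\<And>\<theta>. X \<le> \<theta> \<Longrightarrow> \<theta> < Y \<Longrightarrow> A (circ \<theta>) = B (circ \<theta>)"
  shows "A = B"
proof -
  define \<theta> where "\<theta> = min ((X + Y) / 2) (X + 1 / 4)"
  have \<theta>: "X < \<theta>" "\<theta> < Y" "\<theta> < X + 1 / 2" using assms(3) by (auto simp: \<theta>_def min_def)
  have "area (circ X) (circ \<theta>) \<noteq> 0"
    using sin_2pi_pos[of "\<theta> - X"] \<theta> by (simp add: area_circ)
  then show ?thesis
    by (rule linear_eq_on_basis[OF assms(1,2)]) (use assms(3,4) \<theta> in auto)
qed

section \<open>The first return map\<close>

lemma (in circle_gap) sector_iff_in_gap:
  assumes "r > 0" "r' > 0" "t > 0"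
  shows "t *\<^sub>R circ \<theta> \<in> sector (r *\<^sub>R circ V) (r' *\<^sub>R circ V') \<longleftrightarrow> in_gap \<theta>"
proof -
  define \<phi> where "\<phi> = \<theta> + of_int \<lceil>V - \<theta>\<rceil>"
  have \<phi>: "V \<le> \<phi>" "\<phi> < V + 1"
    using ceiling_correct[of "V - \<theta>"] unfolding \<phi>_def by linarith+
  have eq: "eqz \<phi> \<theta>" "circ \<phi> = circ \<theta>" by (simp_all add: \<phi>_def)
  have "in_gap \<theta> \<longleftrightarrow> \<phi> < V'"
  proof
    assume "in_gap \<theta>"
    then obtain y where y: "V \<le> y" "y < V'" "eqz \<theta> y" unfolding in_gap_def by blast
    then have "\<phi> = y" using eqz_trans[OF eq(1) y(3)] \<phi> gap1 by (intro eqz_unique) auto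
    then show "\<phi> < V'" using y by simp
  next
    assume "\<phi> < V'"
    then show "in_gap \<theta>" unfolding in_gap_def using \<phi> eqz_sym[OF eq(1)] by blast
  qed
  moreover have "t *\<^sub>R circ \<phi> \<in> sector (r *\<^sub>R circ V) (r' *\<^sub>R circ V') \<longleftrightarrow> \<phi> < V'"
    using sector_circ[of r r' V V' t \<phi>] assms \<phi> VP PV' gap1 by simp
  ultimately show ?thesis by (simp add: eq)
qed

lemma (in circle_gap) first_return_circ:
  assumes lift: "is_lift (S a b) F" and r: "r > 0" "r' > 0" "t > 0"
  shows "V \<le> \<theta> \<Longrightarrow> \<theta> < P \<Longrightarrow>
      first_return a b (sector (r *\<^sub>R circ V) (r' *\<^sub>R circ V')) (t *\<^sub>R circ \<theta>) =
      (T a b ^^ \<alpha>) (t *\<^sub>R circ \<theta>)"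
    and "P \<le> \<theta> \<Longrightarrow> \<theta> < V' \<Longrightarrow>
      first_return a b (sector (r *\<^sub>R circ V) (r' *\<^sub>R circ V')) (t *\<^sub>R circ \<theta>) =
      (T a b ^^ \<beta>) (t *\<^sub>R circ \<theta>)"
proof -
  let ?J = "sector (r *\<^sub>R circ V) (r' *\<^sub>R circ V')"
  have iff: "(T a b ^^ n) (t *\<^sub>R circ \<theta>) \<in> ?J \<longleftrightarrow> in_gap ((F ^^ n) \<theta>)" for n
  proof -
    obtain s where "s > 0" "(T a b ^^ n) (t *\<^sub>R circ \<theta>) = s *\<^sub>R circ ((F ^^ n) \<theta>)"
      using T_pow_ray[OF lift r(3)] .
    then show ?thesis using sector_iff_in_gap r by simp
  qed
  have least: "first_return a b ?J (t *\<^sub>R circ \<theta>) = (T a b ^^ N) (t *\<^sub>R circ \<theta>)"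
    if "0 < N" "in_gap ((F ^^ N) \<theta>)" "\<And>n. 0 < n \<Longrightarrow> n < N \<Longrightarrow> \<not> in_gap ((F ^^ n) \<theta>)" for N
  proof -
    have "(LEAST k. 0 < k \<and> (T a b ^^ k) (t *\<^sub>R circ \<theta>) \<in> ?J) = N"
      unfolding iff using that by (intro Least_equality) (auto simp: not_less[symmetric])
    then show ?thesis by (simp add: first_return_def)
  qed
  show "V \<le> \<theta> \<Longrightarrow> \<theta> < P \<Longrightarrow>
      first_return a b ?J (t *\<^sub>R circ \<theta>) = (T a b ^^ \<alpha>) (t *\<^sub>R circ \<theta>)"
    using least[OF \<alpha>(2)] left_return left_avoid by blast
  show "P \<le> \<theta> \<Longrightarrow> \<theta> < V' \<Longrightarrow>
      first_return a b ?J (t *\<^sub>R circ \<theta>) = (T a b ^^ \<beta>) (t *\<^sub>R circ \<theta>)"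
    using least[OF \<beta>(2)] right_return right_avoid by blast
qed

lemma piece_circ_iff:
  assumes "r > 0" "r' > 0" "V \<le> V'" "V' < V + 1" "t > 0" "V \<le> \<theta>" "\<theta> < V + 1"
  shows "t *\<^sub>R circ \<theta> \<in> piece (r *\<^sub>R circ V) (r' *\<^sub>R circ V') C c \<longleftrightarrow>
    \<theta> < V' \<and> c \<le> 2 * pi * (\<theta> - V) \<and> (\<forall>c'\<in>C. c < c' \<longrightarrow> 2 * pi * (\<theta> - V) < c')"
  using assms by (simp add: piece_def sector_circ ang_circ)

theorem theorem3p3:
  fixes a b :: real and v0 v v' :: "real \<times> real" and m :: nat and Orb :: "(real \<times> real) set"
  assumes irr: "\<exists>r. has_rotation_number (S a b) r \<and> r \<notin> \<rat>"
    and same_orbit: "\<exists>k::nat. (T a b ^^ k) (0, 1) = (0, -1) \<or> (T a b ^^ k) (0, -1) = (0, 1)"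
    and O_def: "Orb = {(T a b ^^ j) v0 | j. 1 \<le> j \<and> j \<le> m}"
    and O_cover1: "\<forall>k::nat. (T a b ^^ k) (0, 1) = (0, -1) \<longrightarrow>
                     (\<forall>i. 0 < i \<and> i \<le> k \<longrightarrow> (T a b ^^ i) (0, 1) \<in> Orb)"
    and O_cover2: "\<forall>k::nat. (T a b ^^ k) (0, -1) = (0, 1) \<longrightarrow>
                     (\<forall>i. 0 < i \<and> i \<le> k \<longrightarrow> (T a b ^^ i) (0, -1) \<in> Orb)"
    and vO: "v \<in> Orb" and v'Orb: "v' \<in> Orb"
    and not_same_ray: "\<not> (\<exists>t>0. v' = t *\<^sub>R v)"
    and empty_int: "interior (sector v v') \<inter> Orb = {}"
  shows "pl_exactly v v' (first_return a b (sector v v')) 2 \<and>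
         (\<exists>c. pl_division v v' (first_return a b (sector v v')) {c} \<and>
              \<not> (\<exists>C'. C' \<subset> {c} \<and> pl_division v v' (first_return a b (sector v v')) C') \<and>
              (\<forall>M1 M2. linear M1 \<and> linear M2 \<and>
                  (\<forall>w \<in> piece v v' {c} 0. first_return a b (sector v v') w = M1 w) \<and>
                  (\<forall>w \<in> piece v v' {c} c. first_return a b (sector v v') w = M2 w)
                \<longrightarrow> M1 \<circ> M2 = M2 \<circ> M1))"
proof -
  obtain F where lift: "is_lift (S a b) F" and "circle_lift F"
    using irr circle_lift_rotation by metis
  interpret circle_lift F by fact
  let ?f = "first_return a b (sector v v')"

  \<comment> \<open>The earlier of the two break vectors may be \<open>v0\<close> itself, outside
    \<open>Orb\<close>; it is recovered from its image by injectivity of \<open>T\<close>.\<close>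
  have index: "\<exists>s\<le>m. (T a b ^^ s) v0 = e" if e: "T a b e \<in> Orb" for e
  proof -
    obtain j where j: "1 \<le> j" "j \<le> m" "T a b e = (T a b ^^ j) v0"
      using e unfolding O_def by auto
    then obtain s where "j = Suc s" by (cases j) auto
    with j have "e = (T a b ^^ s) v0" "s \<le> m" by (auto dest: T_inject)
    then show ?thesis by blast
  qed
  have break: "(\<exists>s\<le>m. (T a b ^^ s) v0 = (0, 1)) \<and> (\<exists>s\<le>m. (T a b ^^ s) v0 = (0, -1))"
  proof -
    obtain k where "(T a b ^^ k) (0, 1) = (0, -1) \<or> (T a b ^^ k) (0, -1) = (0, 1)"
      using same_orbit by blast
    then consider "(T a b ^^ k) (0, 1) = (0, -1)" "0 < k" | "(T a b ^^ k) (0, -1) = (0, 1)" "0 < k"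
      by (cases k) auto
    then show ?thesis
    proof cases
      case 1
      have "(T a b ^^ 1) (0, 1) \<in> Orb" "(T a b ^^ k) (0, 1) \<in> Orb"
        using 1 by (intro O_cover1[rule_format, OF 1(1)]; simp)+
      then show ?thesis using index[of "(0, 1)"] 1(1) unfolding O_def by auto
    next
      case 2
      have "(T a b ^^ 1) (0, -1) \<in> Orb" "(T a b ^^ k) (0, -1) \<in> Orb"
        using 2 by (intro O_cover2[rule_format, OF 2(1)]; simp)+
      then show ?thesis using index[of "(0, -1)"] 2(1) unfolding O_def by auto
    qed
  qed
  have "v0 \<noteq> 0"
  proof
    assume "v0 = 0"
    then have "(T a b ^^ s) v0 = 0" for s by (induction s) auto
    then show False using break by (auto simp: prod_eq_iff)
  qed
  then obtain r0 X0 where r0: "r0 > 0" and v0: "v0 = r0 *\<^sub>R circ X0"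
    using polar[of v0 0] by blast

  obtain i j where i: "1 \<le> i" "i \<le> m" "v = (T a b ^^ i) v0"
    and j: "1 \<le> j" "j \<le> m" "v' = (T a b ^^ j) v0"
    using vO v'Orb unfolding O_def by blast
  define V where "V = (F ^^ i) X0"
  obtain r where r: "r > 0" and v: "v = r *\<^sub>R circ V"
    using T_pow_ray[OF lift r0, of i X0] i v0 unfolding V_def by metis
  obtain s' where s': "s' > 0" "v' = s' *\<^sub>R circ ((F ^^ j) X0)"
    using T_pow_ray[OF lift r0, of j X0] j v0 by metis
  obtain r' V' where r': "r' > 0" and "V \<le> V'" and V'1: "V' < V + 1" and v': "v' = r' *\<^sub>R circ V'"
    using polar[of v' V] s' by auto
  have "V \<noteq> V'"
    using not_same_ray r r' unfolding v v'
    by (metis divide_pos_pos nonzero_divide_eq_eq order_less_irrefl scaleR_scaleR)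
  with \<open>V \<le> V'\<close> have VV': "V < V'" by simp
  have eqV: "eqz ((F ^^ i) X0) V" by (simp add: V_def)
  have eqV': "eqz ((F ^^ j) X0) V'"
    using s' v' r' ray_eq_iff by metis

  obtain k P where P: "V < P" "P < V'" "eqz ((F ^^ k) P) X0"
    and least: "\<And>t y. 1 \<le> t \<Longrightarrow> t \<le> k \<Longrightarrow> V < y \<Longrightarrow> y < V' \<Longrightarrow> \<not> eqz ((F ^^ t) P) y"
    using backward_visit[OF eqV eqV' _ VV' V'1] i by (metis One_nat_def Suc_le_eq)
  \<comment> \<open>From time \<open>k\<close> on, the orbit of \<open>P\<close> follows that of
    \<open>X0\<close>, so every index of the segment is raised by \<open>k\<close>.\<close>
  have shifted: "eqz ((F ^^ (n + k)) P) ((F ^^ n) X0)" for n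
    using P(3) by (simp add: funpow_add)

  interpret circle_gap F V P V' "j + k" "i + k" "m + k"
  proof
    show "eqz ((F ^^ (j + k)) P) V'" using shifted eqV' eqz_trans by blast
    show "eqz ((F ^^ (i + k)) P) V" using shifted unfolding V_def .
    fix t y assume t: "1 \<le> t" "t \<le> m + k" and y: "V < y" "y < V'"
    \<comment> \<open>Up to time \<open>k\<close> the choice of \<open>P\<close> applies; afterwards
      the orbit point is in \<open>Orb\<close>, hence not in the interior of the sector.\<close>
    show "\<not> eqz y ((F ^^ t) P)"
    proof (cases "t \<le> k")
      case True
      then show ?thesis using least[of t y] t y eqz_sym by blast
    next
      case False
      show ?thesis
      proof
        assume "eqz y ((F ^^ t) P)"
        then have "eqz y ((F ^^ (t - k)) X0)"
          using shifted[of "t - k"] False eqz_trans by simp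
        moreover obtain s where s: "s > 0" "(T a b ^^ (t - k)) v0 = s *\<^sub>R circ ((F ^^ (t - k)) X0)"
          using T_pow_ray[OF lift r0] v0 by metis
        ultimately have "(T a b ^^ (t - k)) v0 = s *\<^sub>R circ y"
          by (simp add: circ_eq_iff[THEN iffD2])
        then have "(T a b ^^ (t - k)) v0 \<in> interior (sector v v')"
          using interior_sector[OF r r' V'1 s(1) y] v v' by simp
        moreover have "(T a b ^^ (t - k)) v0 \<in> Orb"
          using t False unfolding O_def by force
        ultimately show False using empty_int by blast
      qed
    qed
  qed (use P V'1 i j in auto)

  obtain \<rho> where \<rho>: "\<rho> > 0" "(T a b ^^ k) (1 *\<^sub>R circ P) = \<rho> *\<^sub>R circ ((F ^^ k) P)"
    using T_pow_ray[OF lift zero_less_one] .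
  \<comment> \<open>The length is chosen so that \<open>T a b ^^ k\<close> takes \<open>p\<close> to
    \<open>v0\<close> itself and not just to its ray; then \<open>v\<close> and \<open>v'\<close>
    are iterates of \<open>p\<close>.\<close>
  define rp where "rp = r0 / \<rho>"
  define p where "p = rp *\<^sub>R circ P"
  have rp: "rp > 0" using r0 \<rho> by (simp add: rp_def)
  have "circ ((F ^^ k) P) = circ X0" using P(3) by (simp add: circ_eq_iff)
  then have Tp: "(T a b ^^ k) p = v0"
    using \<rho> rp r0 unfolding p_def by (simp add: T_pow_scale v0 rp_def)
  have Tv: "(T a b ^^ (i + k)) p = v" and Tv': "(T a b ^^ (j + k)) p = v'"
    using Tp i j by (simp_all add: funpow_add)

  \<comment> \<open>A zero first coordinate puts the iterate on the ray of a break vector, whose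
    index in the segment becomes a time for \<open>P\<close>; \<open>left_no_break\<close> and
    \<open>right_no_break\<close> exclude this inside the two arcs.\<close>
  have crossing: "\<exists>\<sigma>\<le>m + k. eqz ((F ^^ n) \<theta>) ((F ^^ \<sigma>) P)"
    if zero: "fst ((T a b ^^ n) (circ \<theta>)) = 0" for n \<theta>
  proof -
    obtain s where s: "s > 0" "(T a b ^^ n) (1 *\<^sub>R circ \<theta>) = s *\<^sub>R circ ((F ^^ n) \<theta>)"
      using T_pow_ray[OF lift zero_less_one] .
    obtain u where u: "u > 0" "(T a b ^^ n) (circ \<theta>) = u *\<^sub>R (0, 1) \<or> (T a b ^^ n) (circ \<theta>) = u *\<^sub>R (0, - 1)"
      using fst_eq_0_ray[OF zero] T_pow_nonzero by auto
    then obtain l where l: "l \<le> m" "(T a b ^^ n) (circ \<theta>) = u *\<^sub>R (T a b ^^ l) v0"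
      using break by metis
    obtain q where q: "q > 0" "(T a b ^^ (l + k)) p = q *\<^sub>R circ ((F ^^ (l + k)) P)"
      using T_pow_ray[OF lift rp] unfolding p_def by metis
    have "s *\<^sub>R circ ((F ^^ n) \<theta>) = (u * q) *\<^sub>R circ ((F ^^ (l + k)) P)"
      using s l q Tp by (simp add: funpow_add)
    then have "eqz ((F ^^ n) \<theta>) ((F ^^ (l + k)) P)"
      using ray_eq_iff[of s "u * q"] s u q by simp
    then show ?thesis using l by (intro exI[of _ "l + k"]) simp
  qed
  obtain L1 where L1: "linear L1" "\<And>u w. area (L1 u) (L1 w) = area u w"
    and L1_eq: "\<And>t \<theta>. t \<ge> 0 \<Longrightarrow> V \<le> \<theta> \<Longrightarrow> \<theta> \<le> P \<Longrightarrow> (T a b ^^ (j + k)) (t *\<^sub>R circ \<theta>) = L1 (t *\<^sub>R circ \<theta>)"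
    using T_pow_linear_on_arc[of "j + k" V P a b] crossing left_no_break by metis
  obtain L2 where L2: "linear L2" "\<And>u w. area (L2 u) (L2 w) = area u w"
    and L2_eq: "\<And>t \<theta>. t \<ge> 0 \<Longrightarrow> P \<le> \<theta> \<Longrightarrow> \<theta> \<le> V' \<Longrightarrow> (T a b ^^ (i + k)) (t *\<^sub>R circ \<theta>) = L2 (t *\<^sub>R circ \<theta>)"
    using T_pow_linear_on_arc[of "i + k" P V' a b] crossing right_no_break by metis
  have ret1: "?f (t *\<^sub>R circ \<theta>) = L1 (t *\<^sub>R circ \<theta>)" if "t > 0" "V \<le> \<theta>" "\<theta> < P" for t \<theta>
    using first_return_circ(1)[OF lift r r' that] L1_eq that unfolding v v' by simp
  have ret2: "?f (t *\<^sub>R circ \<theta>) = L2 (t *\<^sub>R circ \<theta>)" if "t > 0" "P \<le> \<theta>" "\<theta> < V'" for t \<theta>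
    using first_return_circ(2)[OF lift r r' that] L2_eq that unfolding v v' by simp
  \<comment> \<open>\<open>L1 p\<close> is a boundary value: \<open>p\<close> itself belongs to the
    second piece, but the first formula holds on the closed arc.\<close>
  have L1p: "L1 p = v'" and L2p: "L2 p = v"
    using L1_eq[of rp P] L2_eq[of rp P] rp VP PV' Tv Tv' unfolding p_def by auto

  define c where "c = 2 * pi * (P - V)"
  have c: "0 < c" "c < ang v v'"
    using ang_circ[OF r r'] VP PV' V'1 unfolding v v' c_def by auto
  have piece_iff: "t *\<^sub>R circ \<theta> \<in> piece v v' C d \<longleftrightarrow>
      \<theta> < V' \<and> d \<le> 2 * pi * (\<theta> - V) \<and> (\<forall>c'\<in>C. d < c' \<longrightarrow> 2 * pi * (\<theta> - V) < c')"
    if "t > 0" "V \<le> \<theta>" "\<theta> < V + 1" for t \<theta> C d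
    using piece_circ_iff[OF r r' _ V'1 that] VV' unfolding v v' by simp
  have piece_polar: "\<exists>t \<theta>. t > 0 \<and> V \<le> \<theta> \<and> \<theta> < V + 1 \<and> w = t *\<^sub>R circ \<theta>"
    if "w \<in> piece v v' C d" for w C d
    using that polar[of w V] unfolding piece_def sector_def by blast
  have on1: "?f w = L1 w" if w: "w \<in> piece v v' {c} 0" for w
  proof -
    obtain t \<theta> where t: "t > 0" "V \<le> \<theta>" "\<theta> < V + 1" "w = t *\<^sub>R circ \<theta>"
      using piece_polar[OF w] by blast
    then have "2 * pi * (\<theta> - V) < c" using w c piece_iff[OF t(1-3)] by simp
    then have "\<theta> < P" by (simp add: c_def)
    then show ?thesis using ret1 t by simp
  qed
  have on2: "?f w = L2 w" if w: "w \<in> piece v v' {c} c" for w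
  proof -
    obtain t \<theta> where t: "t > 0" "V \<le> \<theta>" "\<theta> < V + 1" "w = t *\<^sub>R circ \<theta>"
      using piece_polar[OF w] by blast
    then have "c \<le> 2 * pi * (\<theta> - V)" "\<theta> < V'" using w piece_iff[OF t(1-3)] by auto
    then have "P \<le> \<theta>" by (simp add: c_def)
    then show ?thesis using ret2 t \<open>\<theta> < V'\<close> by simp
  qed
  \<comment> \<open>Each piece contains a basis, so its linear map is unique; this serves both
    minimality and arbitrary \<open>M1\<close>, \<open>M2\<close>.\<close>
  have left_unique: "M = L1"
    if M: "linear M" "\<And>\<theta>. V \<le> \<theta> \<Longrightarrow> \<theta> < P \<Longrightarrow> ?f (circ \<theta>) = M (circ \<theta>)" for M
    using linear_eq_on_sector[OF M(1) L1(1) VP] M(2) ret1[of 1] by simp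
  have right_unique: "M = L2"
    if M: "linear M" "\<And>\<theta>. P \<le> \<theta> \<Longrightarrow> \<theta> < V' \<Longrightarrow> ?f (circ \<theta>) = M (circ \<theta>)" for M
    using linear_eq_on_sector[OF M(1) L2(1) PV'] M(2) ret2[of 1] by simp

  have division: "pl_division v v' ?f {c}"
    unfolding pl_division_def using c L1(1) L2(1) on1 on2 by auto
  have minimal: "\<not> (\<exists>C'. C' \<subset> {c} \<and> pl_division v v' ?f C')"
  proof
    assume "\<exists>C'. C' \<subset> {c} \<and> pl_division v v' ?f C'"
    \<comment> \<open>Without a division point one linear map would equal both \<open>L1\<close> and
      \<open>L2\<close>, and evaluation at \<open>p\<close> would give
      \<open>v = v'\<close>.\<close>
    then have "pl_division v v' ?f {}" by (metis subset_singletonD psubset_eq)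
    then obtain M where M: "linear M" "\<forall>w\<in>piece v v' {} 0. ?f w = M w"
      unfolding pl_division_def by auto
    have "?f (circ \<theta>) = M (circ \<theta>)" if "V \<le> \<theta>" "\<theta> < V'" for \<theta>
      using M(2) piece_iff[of 1 \<theta> "{}" 0] that V'1 by simp
    then have "M = L1" "M = L2"
      using left_unique[OF M(1)] right_unique[OF M(1)] VP PV' by simp_all
    then have "v' = 1 *\<^sub>R v" using L1p L2p by simp
    then show False using not_same_ray zero_less_one by blast
  qed
  have commute: "L1 \<circ> L2 = L2 \<circ> L1"
  proof (rule area_preserving_commute[OF L1(1) L2(1) L1(2) L2(2) _ L1p L2p _ _ _ _ not_same_ray])
    show "p \<noteq> 0" using rp by (simp add: p_def)
    \<comment> \<open>\<open>v\<close> and \<open>v'\<close> are iterates of \<open>p\<close> and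
      end points of the closed arcs, so \<open>L1 v\<close> and \<open>L2 v'\<close> are both
      \<open>p\<close> iterated \<open>j + k + (i + k)\<close> times.\<close>
    have L1v: "L1 v = (T a b ^^ (j + k + (i + k))) p"
      using L1_eq[of r V] r VP Tv unfolding v by (simp add: funpow_add)
    have "L2 v' = (T a b ^^ (i + k + (j + k))) p"
      using L2_eq[of r' V'] r' PV' Tv' unfolding v' by (simp add: funpow_add)
    then show "L1 v = L2 v'" using L1v by (simp only: add.commute)
    \<comment> \<open>A positive multiple would put a later iterate of \<open>p\<close> back on its
      own ray, against aperiodicity.\<close>
    show "d \<le> 0" if d: "L1 v = d *\<^sub>R p" for d
    proof (rule ccontr)
      assume "\<not> d \<le> 0"
      then have d0: "d * rp > 0" using rp by simp
      let ?n = "j + k + (i + k)"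
      obtain q where q: "q > 0" "(T a b ^^ ?n) p = q *\<^sub>R circ ((F ^^ ?n) P)"
        using T_pow_ray[OF lift rp] unfolding p_def by metis
      have "q *\<^sub>R circ ((F ^^ ?n) P) = (d * rp) *\<^sub>R circ P"
        using d L1v q by (simp add: p_def)
      then have "?n = 0" using ray_eq_iff[OF q(1) d0] eqz_pow_self by blast
      then show False using i by simp
    qed
    show "d \<le> 0" if d: "v = d *\<^sub>R p" for d
    proof (rule ccontr)
      assume "\<not> d \<le> 0"
      then have d0: "d * rp > 0" using rp by simp
      have "r *\<^sub>R circ V = (d * rp) *\<^sub>R circ P" using d v by (simp add: p_def)
      then have "eqz V P" using ray_eq_iff[OF r d0] by blast
      then show False using eqz_unique[of V P] VP PV' V'1 by simp
    qed
    show "d \<le> 0" if d: "v' = d *\<^sub>R p" for d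
    proof (rule ccontr)
      assume "\<not> d \<le> 0"
      then have d0: "d * rp > 0" using rp by simp
      have "r' *\<^sub>R circ V' = (d * rp) *\<^sub>R circ P" using d v' by (simp add: p_def)
      then have "eqz V' P" using ray_eq_iff[OF r' d0] by blast
      then show False using eqz_unique[of V' P] VP PV' V'1 by simp
    qed
  qed
  have "M1 \<circ> M2 = M2 \<circ> M1"
    if M: "linear M1" "linear M2" "\<forall>w \<in> piece v v' {c} 0. ?f w = M1 w"
      "\<forall>w \<in> piece v v' {c} c. ?f w = M2 w" for M1 M2
  proof -
    have "?f (circ \<theta>) = M1 (circ \<theta>)" if "V \<le> \<theta>" "\<theta> < P" for \<theta>
      using M(3) piece_iff[of 1 \<theta> "{c}" 0] that PV' V'1 by (simp add: c_def)
    then have "M1 = L1" using left_unique[OF M(1)] by simp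
    moreover have "?f (circ \<theta>) = M2 (circ \<theta>)" if "P \<le> \<theta>" "\<theta> < V'" for \<theta>
      using M(4) piece_iff[of 1 \<theta> "{c}" c] that VP V'1 by (simp add: c_def)
    then have "M2 = L2" using right_unique[OF M(2)] by simp
    ultimately show ?thesis using commute by simp
  qed
  moreover have "pl_exactly v v' ?f 2"
    unfolding pl_exactly_def using division minimal by (intro exI[of _ "{c}"]) simp
  ultimately show ?thesis using division minimal by blast
qed

end
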